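(* Let $G$ be an almost connected locally compact group, and let $C \subset G$. Then the following are equivalent: (i) $C \in \mathcal{R}(G)$; (ii) $\chi_C \in B(G)$; (iii) $\chi_C$ is a coefficient function of a uniformly bounded representation $(\pi,E)$ of $G$, where $E$ is a reflexive Banach space.
   Context: $G$ is almost connected if $G/G_e$ is compact, where $G_e$ is the connected component of the identity of $G$. $\chi_C$ is the indicator function of $C$. A representation $(\pi,E)$ of a locally compact group $G$ consists of a (complex) Banach space $E$ and a group homomorphism $\pi$ from $G$ into the invertible operators in $\mathcal{B}(E)$ which is continuous with respect to the given topology on $G$ and the strong operator topology on $\mathcal{B}(E)$. It is uniformly bounded if $\sup_{x \in G}\|\pi(x)\| < \infty$. A function $f : G \to \mathbb{C}$ is a coefficient function of $(\pi,E)$ if there are $\xi \in E$ and $\phi \in E^\ast$ with $f(x) = \langle \pi(x)\xi,\phi\rangle$ for all $x \in G$. $\mathcal{R}(G)$, the coset ring of $G$, is the ring of subsets of $G$ generated by all left cosets of open subgroups of $G$. $B(G)$, the Fourier--Stieltjes algebra of $G$, is the algebra of all coefficient functions of unitary representations of $G$ on Hilbert spaces. *)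

theory Defs
  imports
    "HOL-Analysis.Analysis"
    "HOL-Algebra.Algebra"
    "HOL-Algebra.Algebraic_Closure_Type"
begin

section \<open>Locally compact groups and the coset ring\<close>

locale topological_group = group G for G (structure) +
  fixes T :: "'a topology"
  assumes topspace_eq: "topspace T = carrier G"
    and continuous_mult: "continuous_map (prod_topology T T) T (\<lambda>(x, y). x \<otimes> y)"
    and continuous_inv: "continuous_map T T (\<lambda>x. inv x)"

text \<open>As usual in abstract harmonic analysis, locally compact groups are Hausdorff.\<close>

locale locally_compact_group = topological_group +
  assumes Hausdorff: "Hausdorff_space T"
    and locally_compact: "locally_compact_space T"

definition identity_component :: "('g, 'm) monoid_scheme \<Rightarrow> 'g topology \<Rightarrow> 'g set" where
  "identity_component G T = connected_component_of_set T \<one>\<^bsub>G\<^esub>"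

definition quotient_group_topology ::
    "('g, 'm) monoid_scheme \<Rightarrow> 'g topology \<Rightarrow> 'g set \<Rightarrow> 'g set topology" where
  "quotient_group_topology G T N =
     topology (\<lambda>U. U \<subseteq> carrier (G Mod N) \<and> openin T {x \<in> carrier G. N #>\<^bsub>G\<^esub> x \<in> U})"

lemma openin_quotient_group_topology:
  "openin (quotient_group_topology G T N) U \<longleftrightarrow>
     U \<subseteq> carrier (G Mod N) \<and> openin T {x \<in> carrier G. N #>\<^bsub>G\<^esub> x \<in> U}"
proof -
  have "istopology (\<lambda>U. U \<subseteq> carrier (G Mod N) \<and> openin T {x \<in> carrier G. N #>\<^bsub>G\<^esub> x \<in> U})"
  proof -
    have "{x \<in> carrier G. N #>\<^bsub>G\<^esub> x \<in> U \<inter> V}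
        = {x \<in> carrier G. N #>\<^bsub>G\<^esub> x \<in> U} \<inter> {x \<in> carrier G. N #>\<^bsub>G\<^esub> x \<in> V}" for U V
      by blast
    moreover have "{x \<in> carrier G. N #>\<^bsub>G\<^esub> x \<in> \<Union>\<K>}
        = (\<Union>U\<in>\<K>. {x \<in> carrier G. N #>\<^bsub>G\<^esub> x \<in> U})" for \<K>
      by blast
    ultimately show ?thesis
      unfolding istopology_def by (auto simp del: Int_iff Union_iff intro!: openin_Union)
  qed
  then show ?thesis
    by (simp add: quotient_group_topology_def)
qed

definition almost_connected :: "('g, 'm) monoid_scheme \<Rightarrow> 'g topology \<Rightarrow> bool" where
  "almost_connected G T \<longleftrightarrow>
     compact_space (quotient_group_topology G T (identity_component G T))"

definition coset_ring :: "('g, 'm) monoid_scheme \<Rightarrow> 'g topology \<Rightarrow> 'g set set" where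
  "coset_ring G T = \<Inter>{M. ring_of_sets (carrier G) M \<and>
     {x <#\<^bsub>G\<^esub> H |x H. x \<in> carrier G \<and> subgroup H G \<and> openin T H} \<subseteq> M}"


section \<open>Complex Banach and Hilbert spaces on explicit carriers\<close>

text \<open>
  Spaces are records with a carrier, so that one can quantify existentially over them inside
  a formula. The multiplicative fields inherited from rings are not used.
\<close>

record 'v normed_space = "(complex, 'v) module" +
  vnorm :: "'v \<Rightarrow> real"

abbreviation complex_ring :: "complex ring" where
  "complex_ring \<equiv> ring_of_type_algebra"

locale complex_normed_space = module complex_ring E for E :: "'v normed_space" (structure) +
  assumes vnorm_eq_0: "x \<in> carrier E \<Longrightarrow> vnorm E x = 0 \<longleftrightarrow> x = \<zero>"
    and vnorm_smult: "x \<in> carrier E \<Longrightarrow> vnorm E (a \<odot> x) = cmod a * vnorm E x"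
    and vnorm_triangle:
      "x \<in> carrier E \<Longrightarrow> y \<in> carrier E \<Longrightarrow> vnorm E (x \<oplus> y) \<le> vnorm E x + vnorm E y"

text \<open>The value outside the carrier is fixed because the locale \<open>Metric_space\<close> requires
  nonnegativity and symmetry on the whole type.\<close>

definition vdist :: "'v normed_space \<Rightarrow> 'v \<Rightarrow> 'v \<Rightarrow> real" where
  "vdist E x y = (if x \<in> carrier E \<and> y \<in> carrier E then vnorm E (x \<ominus>\<^bsub>E\<^esub> y) else 0)"

definition norm_topology :: "'v normed_space \<Rightarrow> 'v topology" where
  "norm_topology E = Metric_space.mtopology (carrier E) (vdist E)"

locale complex_banach_space = complex_normed_space +
  assumes complete: "Metric_space.mcomplete (carrier E) (vdist E)"

text \<open>The inner product is linear in its first argument and induces the given norm.\<close>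

locale complex_hilbert_space = complex_banach_space +
  fixes ip :: "'a \<Rightarrow> 'a \<Rightarrow> complex"
  assumes ip_add: "\<lbrakk>x \<in> carrier E; y \<in> carrier E; z \<in> carrier E\<rbrakk> \<Longrightarrow> ip (x \<oplus> y) z = ip x z + ip y z"
    and ip_smult: "\<lbrakk>x \<in> carrier E; z \<in> carrier E\<rbrakk> \<Longrightarrow> ip (a \<odot> x) z = a * ip x z"
    and ip_cnj: "\<lbrakk>x \<in> carrier E; y \<in> carrier E\<rbrakk> \<Longrightarrow> ip y x = cnj (ip x y)"
    and ip_self: "x \<in> carrier E \<Longrightarrow> ip x x = complex_of_real ((vnorm E x)\<^sup>2)"

text \<open>Operators are extensional functions, so that equality of operators is equality in HOL.\<close>

definition bounded_ops :: "'v normed_space \<Rightarrow> 'w normed_space \<Rightarrow> ('v \<Rightarrow> 'w) set" where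
  "bounded_ops E F = {S \<in> carrier E \<rightarrow>\<^sub>E carrier F.
     (\<forall>x\<in>carrier E. \<forall>y\<in>carrier E. S (x \<oplus>\<^bsub>E\<^esub> y) = S x \<oplus>\<^bsub>F\<^esub> S y) \<and>
     (\<forall>a. \<forall>x\<in>carrier E. S (a \<odot>\<^bsub>E\<^esub> x) = a \<odot>\<^bsub>F\<^esub> S x) \<and>
     (\<exists>K. \<forall>x\<in>carrier E. vnorm F (S x) \<le> K * vnorm E x)}"

definition op_norm :: "'v normed_space \<Rightarrow> 'w normed_space \<Rightarrow> ('v \<Rightarrow> 'w) \<Rightarrow> real" where
  "op_norm E F S = (SUP x\<in>{x \<in> carrier E. vnorm E x \<le> 1}. vnorm F (S x))"

definition op_space :: "'v normed_space \<Rightarrow> 'w normed_space \<Rightarrow> ('v \<Rightarrow> 'w) normed_space" where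
  "op_space E F = \<lparr>carrier = bounded_ops E F, monoid.mult = undefined, monoid.one = undefined,
     ring.zero = (\<lambda>x\<in>carrier E. \<zero>\<^bsub>F\<^esub>), ring.add = (\<lambda>S R. \<lambda>x\<in>carrier E. S x \<oplus>\<^bsub>F\<^esub> R x),
     module.smult = (\<lambda>a S. \<lambda>x\<in>carrier E. a \<odot>\<^bsub>F\<^esub> S x), vnorm = op_norm E F\<rparr>"

definition complex_space :: "complex normed_space" where
  "complex_space = \<lparr>carrier = UNIV, monoid.mult = (*), monoid.one = 1, ring.zero = 0, ring.add = (+),
     module.smult = (*), vnorm = cmod\<rparr>"

definition dual_space :: "'v normed_space \<Rightarrow> ('v \<Rightarrow> complex) normed_space" where
  "dual_space E = op_space E complex_space"

definition reflexive_space :: "'v normed_space \<Rightarrow> bool" where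
  "reflexive_space E \<longleftrightarrow>
     (\<lambda>x. \<lambda>\<phi>\<in>carrier (dual_space E). \<phi> x) ` carrier E = carrier (dual_space (dual_space E))"


section \<open>Representations\<close>

definition op_monoid :: "'v normed_space \<Rightarrow> ('v \<Rightarrow> 'v) monoid" where
  "op_monoid E = \<lparr>carrier = bounded_ops E E, monoid.mult = compose (carrier E), monoid.one = (\<lambda>x\<in>carrier E. x)\<rparr>"

text \<open>The topology of pointwise norm convergence.\<close>

definition strong_op_topology :: "'v normed_space \<Rightarrow> ('v \<Rightarrow> 'v) topology" where
  "strong_op_topology E =
     subtopology (product_topology (\<lambda>_. norm_topology E) (carrier E)) (bounded_ops E E)"

definition banach_representation ::
    "('g, 'm) monoid_scheme \<Rightarrow> 'g topology \<Rightarrow> 'v normed_space \<Rightarrow> ('g \<Rightarrow> 'v \<Rightarrow> 'v) \<Rightarrow> bool" where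
  "banach_representation G T E \<pi> \<longleftrightarrow> complex_banach_space E \<and>
     \<pi> \<in> hom G (units_of (op_monoid E)) \<and> continuous_map T (strong_op_topology E) \<pi>"

definition uniformly_bounded ::
    "('g, 'm) monoid_scheme \<Rightarrow> 'v normed_space \<Rightarrow> ('g \<Rightarrow> 'v \<Rightarrow> 'v) \<Rightarrow> bool" where
  "uniformly_bounded G E \<pi> \<longleftrightarrow> bdd_above ((\<lambda>x. op_norm E E (\<pi> x)) ` carrier G)"

text \<open>Invertibility of the operators is part of \<open>banach_representation\<close>, so preservation of the
  inner product makes them unitary.\<close>

definition unitary_representation ::
    "('g, 'm) monoid_scheme \<Rightarrow> 'g topology \<Rightarrow> 'v normed_space \<Rightarrow> ('v \<Rightarrow> 'v \<Rightarrow> complex) \<Rightarrow>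
      ('g \<Rightarrow> 'v \<Rightarrow> 'v) \<Rightarrow> bool" where
  "unitary_representation G T E ip \<pi> \<longleftrightarrow> complex_hilbert_space E ip \<and> banach_representation G T E \<pi> \<and>
     (\<forall>g\<in>carrier G. \<forall>x\<in>carrier E. \<forall>y\<in>carrier E. ip (\<pi> g x) (\<pi> g y) = ip x y)"

text \<open>Functions on \<open>G\<close> are functions on the type whose values outside the carrier are ignored.\<close>

definition coefficient_function ::
    "('g, 'm) monoid_scheme \<Rightarrow> 'v normed_space \<Rightarrow> ('g \<Rightarrow> 'v \<Rightarrow> 'v) \<Rightarrow> ('g \<Rightarrow> complex) \<Rightarrow> bool" where
  "coefficient_function G E \<pi> f \<longleftrightarrow>
     (\<exists>\<xi>\<in>carrier E. \<exists>\<phi>\<in>carrier (dual_space E). \<forall>x\<in>carrier G. f x = \<phi> (\<pi> x \<xi>))"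

text \<open>
  The type argument is the universe containing the vectors of the representation spaces.
  For the universe \<^typ>\<open>'g \<Rightarrow> complex\<close> the set is the full algebra \<open>B(G)\<close>: given
  \<open>f(x) = \<langle>\<pi>(x)\<xi>, \<phi>\<rangle>\<close> on \<open>E\<close>, passing to the closed span of the orbit of
  \<open>\<xi>\<close> and dividing by the kernel of \<open>\<eta> \<mapsto> (x \<mapsto> \<langle>\<pi>(x)\<eta>, \<phi>\<rangle>)\<close> realises
  \<open>f\<close> on a space of functions on \<open>G\<close>. The same reduction applies to uniformly bounded
  representations on reflexive spaces, since closed subspaces and quotients of reflexive spaces
  are reflexive.
\<close>

definition fourier_stieltjes ::
    "('g, 'm) monoid_scheme \<Rightarrow> 'g topology \<Rightarrow> 'v itself \<Rightarrow> ('g \<Rightarrow> complex) set" where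
  "fourier_stieltjes G T (_ :: 'v itself) =
     {f. \<exists>(E :: 'v normed_space) ip \<pi>. unitary_representation G T E ip \<pi> \<and>
           coefficient_function G E \<pi> f}"

end

theory Submission
  imports Defs
begin

text \<open>
  In an almost connected group all three conditions say that \<open>C\<close> is open and closed.

  A coefficient function of a strongly continuous representation is continuous, because it is the
  composition of the orbit map of a vector with a bounded functional. If an indicator function is
  continuous then its set is clopen. Cosets of open subgroups are clopen, and the clopen sets form a
  ring, so the sets in the coset ring are clopen too.

  Conversely let \<open>C\<close> be clopen and let \<open>H\<close> consist of the \<open>h\<close> with \<open>h C = C\<close>. Write \<open>N\<close> for
  the identity component. Each coset of \<open>N\<close> is connected, hence lies in \<open>C\<close> or misses it, so only
  the compact space \<open>G/N\<close> matters. Locally around each point, all small enough translations respect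
  \<open>C\<close>; compactness of \<open>G/N\<close> makes this uniform, so that \<open>H\<close> contains a neighbourhood of the
  identity (\<open>openin_left_stabilizer\<close>). Thus \<open>H\<close> is an open subgroup, and by compactness again
  it has finite index (\<open>open_subgroup_finite_index\<close>). Two conclusions follow. First, \<open>C\<close> is a finite
  union of cosets of an open subgroup and so lies in the coset ring (\<open>clopen_in_coset_ring\<close>).
  Secondly, \<open>G\<close> permutes the finite set of cosets of \<open>H\<close>, and the indicator function of \<open>C\<close>
  is a coefficient function of the resulting unitary representation on a finite-dimensional \<open>\<ell>\<^sup>2\<close>
  space (\<open>clopen_indicator_coefficient\<close>). Such a space is at once a Hilbert space and a
  reflexive Banach space, so this one representation serves for both representation-theoretic
  conditions.
\<close>

section \<open>Clopen subsets of topological groups\<close>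

context topological_group
begin

lemma openin_subset_carrier: "openin T U \<Longrightarrow> U \<subseteq> carrier G"
  using openin_subset topspace_eq by blast

lemma continuous_left_translation:
  assumes "a \<in> carrier G" shows "continuous_map T T (\<lambda>x. a \<otimes> x)"
proof -
  have "continuous_map T (prod_topology T T) (\<lambda>x. (a, x))"
    using assms by (simp add: continuous_map_paired topspace_eq)
  from continuous_map_compose[OF this continuous_mult] show ?thesis
    by (simp add: o_def)
qed

lemma continuous_right_translation:
  assumes "a \<in> carrier G" shows "continuous_map T T (\<lambda>x. x \<otimes> a)"
proof -
  have "continuous_map T (prod_topology T T) (\<lambda>x. (x, a))"
    using assms by (simp add: continuous_map_paired topspace_eq)
  from continuous_map_compose[OF this continuous_mult] show ?thesis
    by (simp add: o_def)
qed

lemma openin_left_preimage: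
  "\<lbrakk>openin T U; a \<in> carrier G\<rbrakk> \<Longrightarrow> openin T {x \<in> carrier G. a \<otimes> x \<in> U}"
  using openin_continuous_map_preimage[OF continuous_left_translation] by (simp add: topspace_eq)

lemma openin_right_preimage:
  "\<lbrakk>openin T U; a \<in> carrier G\<rbrakk> \<Longrightarrow> openin T {x \<in> carrier G. x \<otimes> a \<in> U}"
  using openin_continuous_map_preimage[OF continuous_right_translation] by (simp add: topspace_eq)

lemma openin_inv_preimage: "openin T U \<Longrightarrow> openin T {x \<in> carrier G. inv x \<in> U}"
  using openin_continuous_map_preimage[OF continuous_inv] by (simp add: topspace_eq)

lemma openin_r_coset:
  assumes "openin T U" "a \<in> carrier G" shows "openin T (U #> a)"
proof -
  have "U #> a = {x \<in> carrier G. x \<otimes> inv a \<in> U}"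
    using assms(2) openin_subset_carrier[OF assms(1)]
    by (force simp: r_coset_def inv_solve_right' m_assoc)
  then show ?thesis
    using openin_right_preimage[OF assms(1), of "inv a"] assms(2) by simp
qed

lemma openin_l_coset:
  assumes "openin T U" "a \<in> carrier G" shows "openin T (a <#\<^bsub>G\<^esub> U)"
proof -
  have "a <#\<^bsub>G\<^esub> U = {x \<in> carrier G. inv a \<otimes> x \<in> U}"
    using assms(2) openin_subset_carrier[OF assms(1)]
    by (force simp: l_coset_def inv_solve_left' m_assoc[symmetric])
  then show ?thesis
    using openin_left_preimage[OF assms(1), of "inv a"] assms(2) by simp
qed

lemma openin_subgroup_if_nbhd:
  assumes "subgroup H G" "openin T V" "\<one> \<in> V" "V \<subseteq> H"
  shows "openin T H"
proof -
  interpret H: subgroup H G by fact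
  have "H = (\<Union>h\<in>H. V #> h)"
  proof
    show "H \<subseteq> (\<Union>h\<in>H. V #> h)"
      using assms(3) H.mem_carrier by (force simp: r_coset_def)
    show "(\<Union>h\<in>H. V #> h) \<subseteq> H"
      using assms(4) by (force simp: r_coset_def)
  qed
  then show ?thesis
    using openin_r_coset[OF assms(2)] H.mem_carrier by (metis (no_types, lifting) imageE openin_Union)
qed

text \<open>
  The complement of a coset is the union of the other cosets, each of which is open.
\<close>

lemma closedin_l_coset_open_subgroup:
  assumes "subgroup H G" "openin T H" "x \<in> carrier G"
  shows "closedin T (x <#\<^bsub>G\<^esub> H)"
proof -
  interpret H: subgroup H G by fact
  have sub: "x <#\<^bsub>G\<^esub> H \<subseteq> carrier G"
    using openin_l_coset[OF assms(2,3)] openin_subset_carrier by blast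
  have in_coset: "y \<in> x <#\<^bsub>G\<^esub> H" if "y \<in> carrier G" "h \<in> H" "y \<otimes> h \<in> x <#\<^bsub>G\<^esub> H" for y h
  proof -
    from that(3) obtain k where k: "k \<in> H" "y \<otimes> h = x \<otimes> k"
      by (auto simp: l_coset_def)
    have "y = (y \<otimes> h) \<otimes> inv h"
      using that(1,2) H.mem_carrier by (simp add: m_assoc)
    also have "\<dots> = x \<otimes> (k \<otimes> inv h)"
      using k that(2) assms(3) H.mem_carrier by (simp add: m_assoc)
    finally show ?thesis
      using k(1) that(2) by (auto simp: l_coset_def)
  qed
  have "carrier G - (x <#\<^bsub>G\<^esub> H) = (\<Union>y\<in>carrier G - (x <#\<^bsub>G\<^esub> H). y <#\<^bsub>G\<^esub> H)"
  proof (intro equalityI subsetI)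
    fix y assume y: "y \<in> carrier G - (x <#\<^bsub>G\<^esub> H)"
    then have "y = y \<otimes> \<one>" by simp
    then have "y \<in> y <#\<^bsub>G\<^esub> H"
      using H.one_closed unfolding l_coset_def by blast
    then show "y \<in> (\<Union>y\<in>carrier G - (x <#\<^bsub>G\<^esub> H). y <#\<^bsub>G\<^esub> H)"
      using y by (rule UN_I[rotated])
  next
    fix z assume "z \<in> (\<Union>y\<in>carrier G - (x <#\<^bsub>G\<^esub> H). y <#\<^bsub>G\<^esub> H)"
    then obtain y h where "y \<in> carrier G" "y \<notin> x <#\<^bsub>G\<^esub> H" "h \<in> H" "z = y \<otimes> h"
      by (auto simp: l_coset_def)
    then show "z \<in> carrier G - (x <#\<^bsub>G\<^esub> H)"
      using in_coset[of y h] H.mem_carrier by auto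
  qed
  moreover have "openin T (\<Union>y\<in>carrier G - (x <#\<^bsub>G\<^esub> H). y <#\<^bsub>G\<^esub> H)"
    using openin_l_coset[OF assms(2)] by (intro openin_Union) auto
  ultimately show ?thesis
    using sub by (simp add: closedin_def topspace_eq)
qed

text \<open>
  The clopen sets are a ring that contains the generators of the coset ring.
\<close>

lemma coset_ring_clopen:
  assumes "C \<in> coset_ring G T"
  shows "openin T C" "closedin T C"
proof -
  let ?M = "{A. openin T A \<and> closedin T A}"
  have "ring_of_sets (carrier G) ?M"
    by (rule ring_of_setsI) (auto dest: openin_subset_carrier)
  moreover have "{x <#\<^bsub>G\<^esub> H |x H. x \<in> carrier G \<and> subgroup H G \<and> openin T H} \<subseteq> ?M"
    using openin_l_coset closedin_l_coset_open_subgroup by auto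
  ultimately have "C \<in> ?M"
    using assms unfolding coset_ring_def by blast
  then show "openin T C" "closedin T C" by auto
qed

text \<open>
  Translations, inversion and conjugations are homeomorphisms, so they permute the connected
  components; each one that sends some element of the identity component into the identity component
  preserves it.
\<close>

lemma identity_component_normal: "identity_component G T \<lhd> G"
proof -
  let ?N = "identity_component G T"
  have one: "\<one> \<in> ?N"
    by (simp add: identity_component_def connected_component_of_refl topspace_eq)
  have sub: "?N \<subseteq> carrier G"
    using connected_component_of_subset_topspace[of T \<one>] by (simp add: identity_component_def topspace_eq)
  have conn: "connectedin T ?N"
    by (simp add: identity_component_def connectedin_connected_component_of)
  have img: "f ` ?N \<subseteq> ?N" if "continuous_map T T f" "f x \<in> ?N" "x \<in> ?N" for f x
  proof -
    have "connectedin T (f ` ?N)"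
      using that(1) conn by (rule connectedin_continuous_map_image)
    then have "f ` ?N \<subseteq> connected_component_of_set T (f x)"
      by (rule connected_component_of_maximal) (use that in auto)
    moreover have "connected_component_of_set T (f x) = ?N"
      using that(2) by (metis identity_component_def connected_component_of_equiv mem_Collect_eq)
    ultimately show ?thesis by simp
  qed
  have "subgroup ?N G"
  proof (rule subgroupI)
    show "inv a \<in> ?N" if "a \<in> ?N" for a
      using img[OF continuous_inv, of \<one>] one that by auto
    show "a \<otimes> b \<in> ?N" if "a \<in> ?N" "b \<in> ?N" for a b
      using img[OF continuous_left_translation, of a \<one>] one that sub by auto
  qed (use one sub in auto)
  moreover have "x \<otimes> h \<otimes> inv x \<in> ?N" if "x \<in> carrier G" "h \<in> ?N" for x h
  proof -
    have "continuous_map T T (\<lambda>h. x \<otimes> h \<otimes> inv x)"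
      using continuous_map_compose[OF continuous_left_translation continuous_right_translation]
        that(1) by (simp add: o_def)
    from img[OF this, of \<one>] show ?thesis
      using one that by auto
  qed
  ultimately show ?thesis
    by (simp add: normal_inv_iff)
qed

text \<open>
  The translate of the identity component by \<open>y\<close> is a connected set through \<open>y\<close>, so a clopen set
  cannot separate its points.
\<close>

lemma clopen_identity_component_invariant:
  assumes "openin T C" "closedin T C" "n \<in> identity_component G T" "y \<in> carrier G"
  shows "n \<otimes> y \<in> C \<longleftrightarrow> y \<in> C" "y \<otimes> n \<in> C \<longleftrightarrow> y \<in> C"
proof -
  let ?N = "identity_component G T"
  have conn: "connectedin T ?N"
    by (simp add: identity_component_def connectedin_connected_component_of)
  have one: "\<one> \<in> ?N"
    by (simp add: identity_component_def connected_component_of_refl topspace_eq)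
  have *: "f n \<in> C \<longleftrightarrow> f \<one> \<in> C" if "continuous_map T T f" for f
    using connectedin_clopen_cases[OF connectedin_continuous_map_image[OF that conn] assms(2,1)]
      one assms(3) by (auto simp: disjnt_iff)
  show "n \<otimes> y \<in> C \<longleftrightarrow> y \<in> C"
    using *[OF continuous_right_translation[OF assms(4)]] assms(4) by simp
  show "y \<otimes> n \<in> C \<longleftrightarrow> y \<in> C"
    using *[OF continuous_left_translation[OF assms(4)]] assms(4) by simp
qed

text \<open>
  Compactness of the quotient by the identity component \<open>N\<close>, without mentioning the quotient: open
  covers have finite subcovers when every member of the cover is a union of cosets of \<open>N\<close>, since
  such sets are the preimages of the open sets of the quotient.
\<close>

lemma almost_connected_finite_subcover:
  assumes "almost_connected G T"
    and cover: "carrier G \<subseteq> (\<Union>i\<in>I. W i)"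
    and op: "\<And>i. i \<in> I \<Longrightarrow> openin T (W i)"
    and inv: "\<And>i n w. \<lbrakk>i \<in> I; n \<in> identity_component G T; w \<in> W i\<rbrakk> \<Longrightarrow> n \<otimes> w \<in> W i"
  obtains J where "finite J" "J \<subseteq> I" "carrier G \<subseteq> (\<Union>i\<in>J. W i)"
proof -
  let ?N = "identity_component G T" let ?Q = "quotient_group_topology G T ?N"
  interpret N: normal ?N G by (rule identity_component_normal)
  define P where "P i = (\<lambda>w. ?N #> w) ` W i" for i
  have pre: "{x \<in> carrier G. ?N #> x \<in> P i} = W i" if "i \<in> I" for i
  proof -
    have "x \<in> W i" if "x \<in> carrier G" "?N #> x = ?N #> w" "w \<in> W i" for x w
    proof -
      have "x \<in> ?N #> w"
        using that(1,2) rcos_self[OF that(1) N.subgroup_axioms] by simp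
      then show ?thesis
        using inv[OF \<open>i \<in> I\<close> _ that(3)] by (auto simp: r_coset_def)
    qed
    then show ?thesis
      using openin_subset_carrier[OF op[OF that]] by (auto simp: P_def)
  qed
  have opP: "openin ?Q (P i)" if "i \<in> I" for i
    using pre[OF that] op[OF that] openin_subset_carrier[OF op[OF that]]
    by (auto simp: openin_quotient_group_topology carrier_FactGroup P_def)
  have top: "topspace ?Q \<subseteq> (\<Union>i\<in>I. P i)"
  proof
    fix A assume "A \<in> topspace ?Q"
    then have "A \<in> carrier (G Mod ?N)"
      by (auto simp: topspace_def openin_quotient_group_topology)
    then show "A \<in> (\<Union>i\<in>I. P i)"
      using cover by (fastforce simp: carrier_FactGroup P_def)
  qed
  have comp: "compactin ?Q (topspace ?Q)"
    using assms(1) by (simp add: almost_connected_def compact_space_def)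
  have opP': "\<And>V. V \<in> P ` I \<Longrightarrow> openin ?Q V"
    using opP by auto
  have "\<exists>F. finite F \<and> F \<subseteq> P ` I \<and> topspace ?Q \<subseteq> \<Union>F"
    by (rule compactinD[OF comp opP' top])
  then obtain F where F: "finite F" "F \<subseteq> P ` I" "topspace ?Q \<subseteq> \<Union>F"
    by (elim exE conjE) (rule that)
  have "\<exists>J\<subseteq>I. finite J \<and> F = P ` J"
    using F(1,2) by (rule finite_subset_image)
  then obtain J where J: "J \<subseteq> I" "finite J" "F = P ` J"
    by blast
  have "carrier G \<subseteq> (\<Union>i\<in>J. W i)"
  proof
    fix x assume x: "x \<in> carrier G"
    obtain i where "i \<in> I" "x \<in> W i" using cover x by blast
    then have "?N #> x \<in> topspace ?Q"
      using openin_subset[OF opP] by (auto simp: P_def)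
    then have "?N #> x \<in> \<Union>(P ` J)" using F(3) J(3) by blast
    then obtain j where "j \<in> J" "?N #> x \<in> P j" by blast
    moreover have "j \<in> I" using \<open>j \<in> J\<close> J(1) by blast
    ultimately show "x \<in> (\<Union>i\<in>J. W i)" using pre[of j] x by blast
  qed
  then show thesis by (rule that[OF J(2,1)])
qed

definition left_stabilizer :: "'a set \<Rightarrow> 'a set" where
  "left_stabilizer C = {h \<in> carrier G. \<forall>y\<in>carrier G. h \<otimes> y \<in> C \<longleftrightarrow> y \<in> C}"

lemma subgroup_left_stabilizer: "subgroup (left_stabilizer C) G"
proof (rule subgroupI)
  show "inv a \<in> left_stabilizer C" if "a \<in> left_stabilizer C" for a
  proof -
    have "inv a \<otimes> y \<in> C \<longleftrightarrow> a \<otimes> (inv a \<otimes> y) \<in> C" if "y \<in> carrier G" for y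
      using \<open>a \<in> left_stabilizer C\<close> that by (auto simp: left_stabilizer_def)
    moreover have "a \<otimes> (inv a \<otimes> y) = y" if "y \<in> carrier G" for y
      using \<open>a \<in> left_stabilizer C\<close> that by (simp add: left_stabilizer_def m_assoc[symmetric])
    ultimately show ?thesis using that by (auto simp: left_stabilizer_def)
  qed
  show "a \<otimes> b \<in> left_stabilizer C" if "a \<in> left_stabilizer C" "b \<in> left_stabilizer C" for a b
    using that by (auto simp: left_stabilizer_def m_assoc)
  have "\<one> \<in> left_stabilizer C" by (simp add: left_stabilizer_def)
  then show "left_stabilizer C \<noteq> {}" by blast
qed (auto simp: left_stabilizer_def)

text \<open>
  Two factors \<open>u\<close> and \<open>v\<close> are needed because the compactness argument below uses one to spread
  from \<open>x\<close> over a neighbourhood of \<open>x\<close> and the other for the translation to be tested there.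
\<close>

lemma nbhd_square_translate:
  assumes "openin T A" "x \<in> A"
  obtains U where "openin T U" "\<one> \<in> U" "\<And>u v. \<lbrakk>u \<in> U; v \<in> U\<rbrakk> \<Longrightarrow> u \<otimes> v \<otimes> x \<in> A"
proof -
  have x: "x \<in> carrier G" using assms openin_subset_carrier by blast
  have "continuous_map (prod_topology T T) T (\<lambda>(u, v). u \<otimes> v \<otimes> x)"
    using continuous_map_compose[OF continuous_mult continuous_right_translation[OF x]]
    by (simp add: o_def case_prod_unfold)
  from openin_continuous_map_preimage[OF this assms(1)]
  have "openin (prod_topology T T) {p \<in> carrier G \<times> carrier G. fst p \<otimes> snd p \<otimes> x \<in> A}"
    by (simp add: topspace_eq case_prod_unfold)
  moreover have "(\<one>, \<one>) \<in> {p \<in> carrier G \<times> carrier G. fst p \<otimes> snd p \<otimes> x \<in> A}"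
    using assms(2) x by simp
  ultimately obtain U V where "openin T U" "openin T V" "\<one> \<in> U" "\<one> \<in> V"
    "U \<times> V \<subseteq> {p \<in> carrier G \<times> carrier G. fst p \<otimes> snd p \<otimes> x \<in> A}"
    by (blast dest: openin_prod_topology_alt[THEN iffD1, rule_format])
  then show thesis
    by (intro that[of "U \<inter> V"]) auto
qed

text \<open>
  By \<open>nbhd_square_translate\<close>, each \<open>x\<close> has a neighbourhood \<open>U\<close> of the identity such that
  \<open>U U x\<close> lies on one side of \<open>C\<close>. Then translation by \<open>v \<in> U\<close> does not move the points of
  \<open>U x\<close> between \<open>C\<close> and its complement, and neither does it move those of
  \<open>U x N\<close>, because \<open>C\<close> is a union of cosets of \<open>N\<close>. Finitely many of the sets \<open>U x N\<close> cover
  the group, and the intersection of the corresponding neighbourhoods stabilizes \<open>C\<close>.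
\<close>

lemma openin_left_stabilizer:
  assumes ac: "almost_connected G T" and C: "openin T C" "closedin T C"
  shows "openin T (left_stabilizer C)"
proof -
  let ?N = "identity_component G T"
  interpret N: normal ?N G by (rule identity_component_normal)
  have "\<exists>U. openin T U \<and> \<one> \<in> U \<and> (\<forall>u\<in>U. \<forall>v\<in>U. u \<otimes> v \<otimes> x \<in> C \<longleftrightarrow> x \<in> C)"
    if "x \<in> carrier G" for x
  proof -
    define A where "A = (if x \<in> C then C else carrier G - C)"
    have "openin T A" "x \<in> A"
      using C that by (auto simp: A_def closedin_def topspace_eq)
    from nbhd_square_translate[OF this] obtain U where
      "openin T U" "\<one> \<in> U" "\<And>u v. \<lbrakk>u \<in> U; v \<in> U\<rbrakk> \<Longrightarrow> u \<otimes> v \<otimes> x \<in> A" by blast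
    then show ?thesis
      by (intro exI[of _ U]) (cases "x \<in> C"; auto simp: A_def)
  qed
  then obtain U where U: "\<And>x. x \<in> carrier G \<Longrightarrow> openin T (U x)" "\<And>x. x \<in> carrier G \<Longrightarrow> \<one> \<in> U x"
    "\<And>x u v. \<lbrakk>x \<in> carrier G; u \<in> U x; v \<in> U x\<rbrakk> \<Longrightarrow> u \<otimes> v \<otimes> x \<in> C \<longleftrightarrow> x \<in> C"
    by metis
  have Uc: "u \<in> carrier G" if "x \<in> carrier G" "u \<in> U x" for x u
    using U(1) that openin_subset_carrier by blast
  \<comment> \<open>This is \<open>U x N\<close>, written as a union of translates of \<open>U\<close> to show that it is open.\<close>
  define W where "W x = (\<Union>n\<in>?N. U x #> (x \<otimes> n))" for x
  have W_iff: "w \<in> W x \<longleftrightarrow> (\<exists>u\<in>U x. \<exists>n\<in>?N. w = u \<otimes> x \<otimes> n)" if "x \<in> carrier G" for w x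
    using that Uc N.mem_carrier by (fastforce simp: W_def r_coset_def m_assoc)
  obtain J where J: "finite J" "J \<subseteq> carrier G" "carrier G \<subseteq> (\<Union>x\<in>J. W x)"
  proof (rule almost_connected_finite_subcover[OF ac, where I = "carrier G" and W = W])
    show "carrier G \<subseteq> (\<Union>x\<in>carrier G. W x)"
    proof
      fix x assume x: "x \<in> carrier G"
      then have "x = \<one> \<otimes> x \<otimes> \<one>" by simp
      then have "x \<in> W x" using W_iff[OF x] U(2)[OF x] N.one_closed by metis
      then show "x \<in> (\<Union>x\<in>carrier G. W x)" using x by blast
    qed
    show "openin T (W x)" if "x \<in> carrier G" for x
      unfolding W_def using openin_r_coset[OF U(1)[OF that]] N.mem_carrier that
      by (intro openin_Union) auto
    show "n \<otimes> w \<in> W x" if x: "x \<in> carrier G" and n: "n \<in> ?N" and "w \<in> W x" for x n w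
    proof -
      obtain u m where um: "u \<in> U x" "m \<in> ?N" "w = u \<otimes> x \<otimes> m"
        using W_iff[OF x] \<open>w \<in> W x\<close> by blast
      let ?z = "u \<otimes> x"
      have z: "?z \<in> carrier G" using Uc[OF x um(1)] x by simp
      \<comment> \<open>Normality moves \<open>n\<close> past \<open>u x\<close>, so that \<open>U x N\<close> is invariant under left translation by \<open>N\<close>.\<close>
      have "n \<otimes> w = ?z \<otimes> (inv ?z \<otimes> n \<otimes> ?z \<otimes> m)"
        using z n um(2) N.mem_carrier unfolding um(3)
        by (simp add: m_assoc[symmetric] del: inv_mult_group)
      moreover have "inv ?z \<otimes> n \<otimes> ?z \<otimes> m \<in> ?N"
        using N.inv_op_closed1[OF z n] um(2) by simp
      ultimately show ?thesis
        using W_iff[OF x] um(1) by blast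
    qed
  qed (use that in blast)
  define V where "V = topspace T \<inter> (\<Inter>x\<in>J. U x)"
  have "openin T V"
    unfolding V_def using J(1,2) U(1) by (cases "J = {}") (auto intro!: openin_Int openin_Inter)
  moreover have "\<one> \<in> V"
    using J(2) U(2) by (auto simp: V_def topspace_eq)
  moreover have "V \<subseteq> left_stabilizer C"
  proof
    fix v assume v: "v \<in> V"
    then have vc: "v \<in> carrier G" by (simp add: V_def topspace_eq)
    have "v \<otimes> y \<in> C \<longleftrightarrow> y \<in> C" if y: "y \<in> carrier G" for y
    proof -
      obtain x where x: "x \<in> J" "y \<in> W x" using J(3) y by blast
      then have xc: "x \<in> carrier G" using J(2) by blast
      obtain u n where un: "u \<in> U x" "n \<in> ?N" "y = u \<otimes> x \<otimes> n"
        using W_iff[OF xc] x(2) by blast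
      have uc: "u \<in> carrier G" using Uc[OF xc un(1)] .
      have vU: "v \<in> U x" using v x(1) by (simp add: V_def)
      \<comment> \<open>Both \<open>y\<close> and \<open>v y\<close> lie, up to a factor in \<open>N\<close>, in the product \<open>U U x\<close>.\<close>
      have "v \<otimes> y = v \<otimes> u \<otimes> x \<otimes> n"
        using vc uc xc un(2,3) N.mem_carrier by (simp add: m_assoc)
      then have "v \<otimes> y \<in> C \<longleftrightarrow> v \<otimes> u \<otimes> x \<in> C"
        using clopen_identity_component_invariant(2)[OF C un(2)] vc uc xc by simp
      moreover have "y \<in> C \<longleftrightarrow> \<one> \<otimes> u \<otimes> x \<in> C"
        using clopen_identity_component_invariant(2)[OF C un(2)] uc xc un(3) by simp
      ultimately show ?thesis
        using U(3)[OF xc vU un(1)] U(3)[OF xc U(2)[OF xc] un(1)] by simp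
    qed
    then show "v \<in> left_stabilizer C"
      using vc by (simp add: left_stabilizer_def)
  qed
  ultimately show ?thesis
    using openin_subgroup_if_nbhd[OF subgroup_left_stabilizer] by blast
qed

text \<open>
  An open subgroup is clopen, so it contains the identity component, and its right cosets are an open
  cover to which \<open>almost_connected_finite_subcover\<close> applies.
\<close>

lemma open_subgroup_finite_index:
  assumes ac: "almost_connected G T" and H: "subgroup H G" "openin T H"
  shows "finite (rcosets H)"
proof -
  interpret H: subgroup H G by fact
  have l: "\<one> <#\<^bsub>G\<^esub> H = H" by (auto simp: l_coset_def H.mem_carrier)
  have cl: "closedin T H"
    using closedin_l_coset_open_subgroup[OF H one_closed] by (simp add: l)
  obtain J where J: "finite J" "J \<subseteq> carrier G" "carrier G \<subseteq> (\<Union>x\<in>J. H #> x)"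
  proof (rule almost_connected_finite_subcover[OF ac, where I = "carrier G" and W = "\<lambda>x. H #> x"])
    show "carrier G \<subseteq> (\<Union>x\<in>carrier G. H #> x)"
      using rcos_self[OF _ H(1)] by blast
    show "openin T (H #> x)" if "x \<in> carrier G" for x
      using openin_r_coset[OF H(2) that] .
    show "n \<otimes> w \<in> H #> x" if x: "x \<in> carrier G" and n: "n \<in> identity_component G T" and w: "w \<in> H #> x" for x n w
    proof -
      interpret N: normal "identity_component G T" G by (rule identity_component_normal)
      obtain h where h: "h \<in> H" "w = h \<otimes> x" using w by (auto simp: r_coset_def)
      have "n \<otimes> h \<in> H"
        using clopen_identity_component_invariant(1)[OF H(2) cl n] h by simp
      moreover have "n \<otimes> w = n \<otimes> h \<otimes> x"
        using x n h by (simp add: m_assoc N.mem_carrier)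
      ultimately show ?thesis by (auto simp: r_coset_def)
    qed
  qed (use that in blast)
  have "rcosets H \<subseteq> (\<lambda>x. H #> x) ` J"
  proof
    fix A assume "A \<in> rcosets H"
    then obtain a where a: "a \<in> carrier G" "A = H #> a" by (auto simp: RCOSETS_def)
    then obtain x where "x \<in> J" "a \<in> H #> x" using J(3) by blast
    then show "A \<in> (\<lambda>x. H #> x) ` J"
      using repr_independence[OF _ _ H(1), of a x] J(2) a by blast
  qed
  then show ?thesis using J(1) finite_surj by blast
qed

text \<open>
  The coset ring is generated by left cosets, so the subgroup is needed that stabilizes \<open>C\<close> on the
  right. It is obtained as the left stabilizer of the set \<open>D\<close> of inverses of elements of \<open>C\<close>.
\<close>

lemma clopen_in_coset_ring:
  assumes ac: "almost_connected G T" and C: "openin T C" "closedin T C"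
  shows "C \<in> coset_ring G T"
proof -
  define D where "D = {x \<in> carrier G. inv x \<in> C}"
  have Cc: "C \<subseteq> carrier G" using C(1) by (rule openin_subset_carrier)
  have D: "openin T D" "closedin T D"
    using openin_inv_preimage[OF C(1)] closedin_continuous_map_preimage[OF continuous_inv C(2)]
    by (simp_all add: D_def topspace_eq)
  let ?H = "left_stabilizer D"
  have H: "subgroup ?H G" "openin T ?H"
    using subgroup_left_stabilizer openin_left_stabilizer[OF ac D] by auto
  interpret H: subgroup ?H G by fact
  have stab: "c \<otimes> h \<in> C" if "c \<in> C" "h \<in> ?H" for c h
  proof -
    have c: "c \<in> carrier G" using that(1) Cc by (rule subsetD[rotated])
    have h: "h \<in> carrier G" "inv h \<in> ?H"
      using that(2) H.mem_carrier H.m_inv_closed by blast+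
    have "inv c \<in> D" using that(1) c by (simp add: D_def)
    then have "inv h \<otimes> inv c \<in> D"
      using h(2) c unfolding left_stabilizer_def by blast
    then show ?thesis using c h(1) by (simp add: D_def inv_mult_group)
  qed
  let ?L = "(\<lambda>c. c <#\<^bsub>G\<^esub> ?H) ` C"
  have "C = \<Union>?L"
  proof
    show "C \<subseteq> \<Union>?L"
    proof
      fix c assume c: "c \<in> C"
      then have "c = c \<otimes> \<one>" using Cc by auto
      then have "c \<in> c <#\<^bsub>G\<^esub> ?H" using H.one_closed unfolding l_coset_def by blast
      then show "c \<in> \<Union>?L" using c by blast
    qed
    show "\<Union>?L \<subseteq> C" using stab by (auto simp: l_coset_def)
  qed
  moreover have "finite ?L"
  proof -
    \<comment> \<open>Inversion turns the finitely many right cosets of the stabilizer into its left cosets.\<close>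
    have "?L \<subseteq> (\<lambda>A. m_inv G ` A) ` (rcosets ?H)"
    proof
      fix A assume "A \<in> ?L"
      then obtain c where c: "c \<in> C" "A = c <#\<^bsub>G\<^esub> ?H" by blast
      have cc: "c \<in> carrier G" using c(1) Cc by blast
      have "A = m_inv G ` (?H #> inv c)"
      proof
        show "A \<subseteq> m_inv G ` (?H #> inv c)"
        proof
          fix a assume "a \<in> A"
          then obtain h where h: "h \<in> ?H" "a = c \<otimes> h" using c(2) by (auto simp: l_coset_def)
          then have "a = inv (inv h \<otimes> inv c)" using cc by (simp add: inv_mult_group)
          then show "a \<in> m_inv G ` (?H #> inv c)" using h(1) by (auto simp: r_coset_def)
        qed
        show "m_inv G ` (?H #> inv c) \<subseteq> A"
          using cc by (auto simp: c(2) r_coset_def l_coset_def inv_mult_group)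
      qed
      then show "A \<in> (\<lambda>A. m_inv G ` A) ` (rcosets ?H)"
        using rcosetsI[OF H.subset, of "inv c"] cc by blast
    qed
    then show ?thesis
      using open_subgroup_finite_index[OF ac H] finite_surj by blast
  qed
  moreover have "?L \<subseteq> {x <#\<^bsub>G\<^esub> H |x H. x \<in> carrier G \<and> subgroup H G \<and> openin T H}"
    using H Cc by blast
  ultimately show ?thesis
    unfolding coset_ring_def
    by (metis (mono_tags, lifting) InterI mem_Collect_eq ring_of_sets.finite_Union subset_trans)
qed

end

section \<open>Continuity of coefficient functions\<close>

lemma complex_ring_simps [simp]:
  "carrier complex_ring = UNIV" "x \<oplus>\<^bsub>complex_ring\<^esub> y = x + y" "x \<otimes>\<^bsub>complex_ring\<^esub> y = x * y"
  "\<zero>\<^bsub>complex_ring\<^esub> = 0" "\<one>\<^bsub>complex_ring\<^esub> = 1"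
  by (simp_all add: ring_of_type_algebra_def)

lemma complex_space_simps [simp]:
  "carrier complex_space = UNIV" "x \<oplus>\<^bsub>complex_space\<^esub> y = x + y"
  "a \<odot>\<^bsub>complex_space\<^esub> x = a * x" "\<zero>\<^bsub>complex_space\<^esub> = 0" "vnorm complex_space x = cmod x"
  by (simp_all add: complex_space_def)

lemma op_space_simps [simp]:
  "carrier (op_space E F) = bounded_ops E F"
  "S \<oplus>\<^bsub>op_space E F\<^esub> R = (\<lambda>x\<in>carrier E. S x \<oplus>\<^bsub>F\<^esub> R x)"
  "a \<odot>\<^bsub>op_space E F\<^esub> S = (\<lambda>x\<in>carrier E. a \<odot>\<^bsub>F\<^esub> S x)"
  "vnorm (op_space E F) S = op_norm E F S"
  by (simp_all add: op_space_def)

context complex_normed_space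
begin

lemma uminus_eq_smult: "x \<in> carrier E \<Longrightarrow> \<ominus>\<^bsub>E\<^esub> x = (- 1) \<odot>\<^bsub>E\<^esub> x"
  using M.minus_equality[of "(- 1) \<odot>\<^bsub>E\<^esub> x" x] smult_l_distr[of "- 1" 1 x] smult_one[of x]
    smult_l_null[of x] smult_closed[of "- 1" x]
  by simp

lemma vnorm_uminus: "x \<in> carrier E \<Longrightarrow> vnorm E (\<ominus>\<^bsub>E\<^esub> x) = vnorm E x"
  using vnorm_smult[of x "- 1"] by (simp add: uminus_eq_smult)

lemma vnorm_nonneg: "x \<in> carrier E \<Longrightarrow> 0 \<le> vnorm E x"
  using vnorm_triangle[of x "\<ominus>\<^bsub>E\<^esub> x"] vnorm_eq_0[of "\<zero>\<^bsub>E\<^esub>"]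
  by (simp add: vnorm_uminus M.r_neg)

sublocale Metric_space "carrier E" "vdist E"
proof
  show "0 \<le> vdist E x y" for x y
    by (simp add: vdist_def vnorm_nonneg)
  show "vdist E x y = vdist E y x" for x y
    using vnorm_uminus[of "x \<ominus>\<^bsub>E\<^esub> y"]
    by (auto simp: vdist_def M.minus_eq M.minus_add M.a_comm)
  show "vdist E x y = 0 \<longleftrightarrow> x = y" if "x \<in> carrier E" "y \<in> carrier E" for x y
  proof -
    have "(x \<ominus>\<^bsub>E\<^esub> y) \<oplus>\<^bsub>E\<^esub> y = x"
      using that by (simp add: M.minus_eq M.a_assoc M.l_neg)
    then have "x \<ominus>\<^bsub>E\<^esub> y = \<zero>\<^bsub>E\<^esub> \<longleftrightarrow> x = y"
      using that by (metis M.l_zero M.minus_eq M.r_neg)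
    then show ?thesis
      using that by (simp add: vdist_def vnorm_eq_0)
  qed
  show "vdist E x z \<le> vdist E x y + vdist E y z"
    if "x \<in> carrier E" "y \<in> carrier E" "z \<in> carrier E" for x y z
  proof -
    have "x \<ominus>\<^bsub>E\<^esub> z = (x \<ominus>\<^bsub>E\<^esub> y) \<oplus>\<^bsub>E\<^esub> (y \<ominus>\<^bsub>E\<^esub> z)"
      using that by (simp add: M.minus_eq M.a_assoc M.r_neg1)
    then show ?thesis
      using that vnorm_triangle[of "x \<ominus>\<^bsub>E\<^esub> y" "y \<ominus>\<^bsub>E\<^esub> z"] by (simp add: vdist_def)
  qed
qed

lemma topspace_norm_topology: "topspace (norm_topology E) = carrier E"
  by (simp add: norm_topology_def)

text \<open>
  A functional with bound \<open>K\<close> is Lipschitz.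
\<close>

lemma continuous_functional:
  assumes "\<phi> \<in> carrier (dual_space E)"
  shows "continuous_map (norm_topology E) euclidean \<phi>"
proof -
  have add: "\<phi> (x \<oplus>\<^bsub>E\<^esub> y) = \<phi> x + \<phi> y" if "x \<in> carrier E" "y \<in> carrier E" for x y
    using assms that by (simp add: dual_space_def bounded_ops_def)
  have "\<exists>K. \<forall>x\<in>carrier E. cmod (\<phi> x) \<le> K * vnorm E x"
    using assms by (simp add: dual_space_def bounded_ops_def)
  then obtain K where K: "\<And>x. x \<in> carrier E \<Longrightarrow> cmod (\<phi> x) \<le> K * vnorm E x"
    by blast
  have lip: "dist (\<phi> x) (\<phi> y) \<le> \<bar>K\<bar> * vdist E x y" if "x \<in> carrier E" "y \<in> carrier E" for x y
  proof -
    have "(x \<ominus>\<^bsub>E\<^esub> y) \<oplus>\<^bsub>E\<^esub> y = x"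
      using that by (simp add: M.minus_eq M.a_assoc M.l_neg)
    then have "\<phi> x - \<phi> y = \<phi> (x \<ominus>\<^bsub>E\<^esub> y)"
      using add[of "x \<ominus>\<^bsub>E\<^esub> y" y] that by simp
    then have "dist (\<phi> x) (\<phi> y) \<le> K * vdist E x y"
      using K[of "x \<ominus>\<^bsub>E\<^esub> y"] that by (simp add: vdist_def dist_norm)
    also have "\<dots> \<le> \<bar>K\<bar> * vdist E x y"
      by (intro mult_right_mono) auto
    finally show ?thesis .
  qed
  have "continuous_map mtopology Met_TC.mtopology \<phi>"
    unfolding metric_continuous_map[OF Met_TC.Metric_space_axioms]
  proof (intro conjI ballI allI impI)
    fix a \<epsilon> assume a: "a \<in> carrier E" and e: "(0::real) < \<epsilon>"
    show "\<exists>\<delta>>0. \<forall>x. x \<in> carrier E \<and> vdist E a x < \<delta> \<longrightarrow> dist (\<phi> a) (\<phi> x) < \<epsilon>"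
    \<comment> \<open>Adding 1 keeps the denominator positive even when \<open>K = 0\<close>.\<close>
    proof (intro exI[of _ "\<epsilon> / (\<bar>K\<bar> + 1)"] conjI allI impI)
      show "0 < \<epsilon> / (\<bar>K\<bar> + 1)" using e by simp
      fix x assume x: "x \<in> carrier E \<and> vdist E a x < \<epsilon> / (\<bar>K\<bar> + 1)"
      have "dist (\<phi> a) (\<phi> x) \<le> (\<bar>K\<bar> + 1) * vdist E a x"
        using lip[OF a] x nonneg[of a x] by (smt (verit) mult_right_mono)
      also have "\<dots> < \<epsilon>"
        using x by (simp add: pos_less_divide_eq mult.commute add_nonneg_pos)
      finally show "dist (\<phi> a) (\<phi> x) < \<epsilon>" .
    qed
  qed auto
  then show ?thesis
    by (simp add: norm_topology_def)
qed

end

lemma continuous_coefficient_function: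
  assumes "banach_representation G T E \<pi>" "coefficient_function G E \<pi> f"
    and top: "topspace T = carrier G"
  shows "continuous_map T euclidean f"
proof -
  interpret complex_banach_space E
    using assms(1) by (simp add: banach_representation_def)
  obtain \<xi> \<phi> where \<xi>: "\<xi> \<in> carrier E" and \<phi>: "\<phi> \<in> carrier (dual_space E)"
    and f: "\<And>x. x \<in> carrier G \<Longrightarrow> f x = \<phi> (\<pi> x \<xi>)"
    using assms(2) by (auto simp: coefficient_function_def)
  have "continuous_map T (product_topology (\<lambda>_. norm_topology E) (carrier E)) \<pi>"
    using assms(1) by (simp add: banach_representation_def strong_op_topology_def continuous_map_in_subtopology)
  then have "continuous_map T (norm_topology E) (\<lambda>x. \<pi> x \<xi>)"
    using \<xi> by (simp add: continuous_map_componentwise)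
  from continuous_map_compose[OF this continuous_functional[OF \<phi>]]
  have "continuous_map T euclidean (\<lambda>x. \<phi> (\<pi> x \<xi>))"
    by (simp add: o_def)
  then show ?thesis
    by (rule continuous_map_eq) (simp add: f top)
qed

lemma clopen_if_continuous_indicator:
  assumes "continuous_map T euclidean (indicator C :: 'g \<Rightarrow> complex)" "C \<subseteq> topspace T"
  shows "openin T C" "closedin T C"
proof -
  have C: "C = {x \<in> topspace T. indicator C x \<in> - {0::complex}}"
    and D: "C = {x \<in> topspace T. indicator C x \<in> {1::complex}}"
    using assms(2) by (auto simp: indicator_def)
  show "openin T C"
    by (subst C) (rule openin_continuous_map_preimage[OF assms(1)], simp add: open_Compl)
  show "closedin T C"
    by (subst D) (rule closedin_continuous_map_preimage[OF assms(1)], simp)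
qed

section \<open>Finite-dimensional Hilbert spaces\<close>

text \<open>
  The vectors are functions on the whole index type, so those on \<open>R\<close> are represented by their extension
  by zero.
\<close>

definition l2_space :: "'i set \<Rightarrow> ('i \<Rightarrow> complex) normed_space" where
  "l2_space R = \<lparr>carrier = {f. \<forall>r. r \<notin> R \<longrightarrow> f r = 0}, monoid.mult = undefined, monoid.one = undefined,
     ring.zero = (\<lambda>_. 0), ring.add = (\<lambda>f g r. f r + g r), module.smult = (\<lambda>a f r. a * f r),
     vnorm = (\<lambda>f. L2_set (\<lambda>r. cmod (f r)) R)\<rparr>"

definition l2_inner :: "'i set \<Rightarrow> ('i \<Rightarrow> complex) \<Rightarrow> ('i \<Rightarrow> complex) \<Rightarrow> complex" where
  "l2_inner R f g = (\<Sum>r\<in>R. f r * cnj (g r))"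

lemma l2_space_simps [simp]:
  "carrier (l2_space R) = {f. \<forall>r. r \<notin> R \<longrightarrow> f r = 0}"
  "\<zero>\<^bsub>l2_space R\<^esub> = (\<lambda>_. 0)"
  "f \<oplus>\<^bsub>l2_space R\<^esub> g = (\<lambda>r. f r + g r)"
  "a \<odot>\<^bsub>l2_space R\<^esub> f = (\<lambda>r. a * f r)"
  "vnorm (l2_space R) f = L2_set (\<lambda>r. cmod (f r)) R"
  by (simp_all add: l2_space_def)

lemma module_l2_space: "module complex_ring (l2_space R)"
proof (rule moduleI)
  show "cring complex_ring" by (rule cring_from_type_algebra)
  show "abelian_group (l2_space R)"
  proof (rule abelian_groupI)
    show "\<exists>g\<in>carrier (l2_space R). g \<oplus>\<^bsub>l2_space R\<^esub> f = \<zero>\<^bsub>l2_space R\<^esub>"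
      if "f \<in> carrier (l2_space R)" for f
      using that by (intro bexI[of _ "\<lambda>r. - f r"]) auto
  qed (auto simp: algebra_simps)
qed (auto simp: algebra_simps)

lemma complex_normed_space_l2_space:
  assumes "finite R"
  shows "complex_normed_space (l2_space R)"
proof -
  interpret module complex_ring "l2_space R" by (rule module_l2_space)
  show ?thesis
  proof unfold_locales
    show "vnorm (l2_space R) f = 0 \<longleftrightarrow> f = \<zero>\<^bsub>l2_space R\<^esub>" if "f \<in> carrier (l2_space R)" for f
      using that assms by (auto simp: L2_set_eq_0_iff)
    show "vnorm (l2_space R) (a \<odot>\<^bsub>l2_space R\<^esub> f) = cmod a * vnorm (l2_space R) f" for a f
      by (simp add: norm_mult L2_set_right_distrib)
    show "vnorm (l2_space R) (f \<oplus>\<^bsub>l2_space R\<^esub> g) \<le> vnorm (l2_space R) f + vnorm (l2_space R) g" for f g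
    proof -
      have "L2_set (\<lambda>r. cmod (f r + g r)) R \<le> L2_set (\<lambda>r. cmod (f r) + cmod (g r)) R"
        by (intro L2_set_mono norm_triangle_ineq norm_ge_zero)
      also have "\<dots> \<le> L2_set (\<lambda>r. cmod (f r)) R + L2_set (\<lambda>r. cmod (g r)) R"
        by (rule L2_set_triangle_ineq)
      finally show ?thesis by simp
    qed
  qed
qed

lemma vdist_l2_space:
  assumes "finite R" "f \<in> carrier (l2_space R)" "g \<in> carrier (l2_space R)"
  shows "vdist (l2_space R) f g = L2_set (\<lambda>r. cmod (f r - g r)) R"
proof -
  interpret complex_normed_space "l2_space R"
    using assms(1) by (rule complex_normed_space_l2_space)
  have "f \<ominus>\<^bsub>l2_space R\<^esub> g = (\<lambda>r. f r - g r)"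
    using uminus_eq_smult[OF assms(3)] by (simp add: a_minus_def)
  then show ?thesis
    using assms by (simp add: vdist_def)
qed

text \<open>
  The coordinates of a Cauchy sequence are Cauchy, and over a finite index set coordinatewise
  convergence implies convergence in norm.
\<close>

lemma complex_banach_space_l2_space:
  assumes R: "finite R"
  shows "complex_banach_space (l2_space R)"
proof -
  let ?E = "l2_space R"
  interpret complex_normed_space ?E
    using R by (rule complex_normed_space_l2_space)
  have "mcomplete"
    unfolding mcomplete_def
  proof (intro allI impI)
    fix \<sigma> assume "MCauchy \<sigma>"
    then have \<sigma>: "\<And>n. \<sigma> n \<in> carrier ?E"
      and C: "\<And>\<epsilon>. \<epsilon> > 0 \<Longrightarrow> \<exists>N. \<forall>n n'. N \<le> n \<longrightarrow> N \<le> n' \<longrightarrow> vdist ?E (\<sigma> n) (\<sigma> n') < \<epsilon>"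
      unfolding MCauchy_def by blast+
    have "\<exists>l. (\<lambda>n. \<sigma> n r) \<longlonglongrightarrow> l" if r: "r \<in> R" for r
    proof -
      have "dist (\<sigma> m r) (\<sigma> n r) \<le> vdist ?E (\<sigma> m) (\<sigma> n)" for m n
        unfolding vdist_l2_space[OF R \<sigma> \<sigma>] dist_norm
        by (rule member_le_L2_set[OF R r])
      then have "Cauchy (\<lambda>n. \<sigma> n r)"
        unfolding Cauchy_def using C by (meson le_less_trans)
      then show ?thesis
        by (simp add: Cauchy_convergent_iff convergent_def)
    qed
    then obtain L where L: "\<And>r. r \<in> R \<Longrightarrow> (\<lambda>n. \<sigma> n r) \<longlonglongrightarrow> L r" by metis
    define l where "l r = (if r \<in> R then L r else 0)" for r
    have lE: "l \<in> carrier ?E" by (simp add: l_def)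
    have "(\<lambda>n. L2_set (\<lambda>r. cmod (\<sigma> n r - l r)) R) \<longlonglongrightarrow> L2_set (\<lambda>r. cmod (l r - l r)) R"
      unfolding L2_set_def
      by (intro tendsto_intros) (simp add: l_def L)
    then have "(\<lambda>n. vdist ?E (\<sigma> n) l) \<longlonglongrightarrow> 0"
      by (simp add: vdist_l2_space[OF R \<sigma> lE] L2_set_def)
    then have "limitin mtopology \<sigma> l sequentially"
      unfolding limitin_metric_dist_null using lE \<sigma> by simp
    then show "\<exists>l. limitin mtopology \<sigma> l sequentially" by blast
  qed
  then show ?thesis
    by unfold_locales
qed

lemma complex_hilbert_space_l2_space:
  assumes R: "finite R"
  shows "complex_hilbert_space (l2_space R) (l2_inner R)"
proof -
  interpret complex_banach_space "l2_space R"
    using R by (rule complex_banach_space_l2_space)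
  show ?thesis
  proof unfold_locales
    show "l2_inner R g f = cnj (l2_inner R f g)" for f g
      by (simp add: l2_inner_def mult.commute)
    show "l2_inner R f f = complex_of_real ((vnorm (l2_space R) f)\<^sup>2)" for f
      by (simp add: l2_inner_def L2_set_def sum_nonneg complex_norm_square del: of_real_power)
  qed (simp_all add: l2_inner_def algebra_simps sum.distrib sum_distrib_left)
qed

text \<open>
  The hypotheses do not include boundedness, so that the expansion can be used to prove that linear
  functionals are bounded.
\<close>

lemma l2_expansion:
  assumes R: "finite R"
    and add: "\<And>g h. \<lbrakk>g \<in> carrier (l2_space R); h \<in> carrier (l2_space R)\<rbrakk> \<Longrightarrow> \<phi> (\<lambda>r. g r + h r) = \<phi> g + (\<phi> h :: complex)"
    and smult: "\<And>a g. g \<in> carrier (l2_space R) \<Longrightarrow> \<phi> (\<lambda>r. a * g r) = a * \<phi> g"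
    and f: "f \<in> carrier (l2_space R)"
  shows "\<phi> f = (\<Sum>r\<in>R. f r * \<phi> (indicator {r}))"
proof -
  have "\<phi> (\<lambda>s. if s \<in> A then f s else 0) = (\<Sum>r\<in>A. f r * \<phi> (indicator {r}))" if "A \<subseteq> R" for A
    using finite_subset[OF that R] that
  proof (induction A rule: finite_induct)
    case empty
    then show ?case using smult[of "\<lambda>_. 0" 0] by simp
  next
    case (insert a A)
    have "(\<lambda>s. if s \<in> insert a A then f s else 0) =
        (\<lambda>s. f a * indicator {a} s + (if s \<in> A then f s else 0))"
      using insert.hyps by (auto simp: fun_eq_iff indicator_def)
    then have "\<phi> (\<lambda>s. if s \<in> insert a A then f s else 0) =
        \<phi> (\<lambda>s. f a * indicator {a} s) + \<phi> (\<lambda>s. if s \<in> A then f s else 0)"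
      using insert.prems by (subst add[symmetric]) (auto simp: indicator_def)
    also have "\<phi> (\<lambda>s. f a * indicator {a} s) = f a * \<phi> (indicator {a})"
      using insert.prems by (intro smult) (auto simp: indicator_def)
    finally show ?case
      using insert by simp
  qed
  from this[of R] have "\<phi> (\<lambda>s. if s \<in> R then f s else 0) = (\<Sum>r\<in>R. f r * \<phi> (indicator {r}))"
    by simp
  moreover have "(\<lambda>s. if s \<in> R then f s else 0) = f"
    using f by (auto simp: fun_eq_iff)
  ultimately show ?thesis by simp
qed

text \<open>
  In finite dimension linear functionals are automatically bounded: by the expansion in the standard
  basis, \<open>|\<phi> f| \<le> (\<Sum>r. |\<phi> e\<^sub>r|) \<parallel>f\<parallel>\<close>.
\<close>

lemma dual_l2_space_iff:
  assumes R: "finite R"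
  shows "\<phi> \<in> carrier (dual_space (l2_space R)) \<longleftrightarrow> \<phi> \<in> extensional (carrier (l2_space R)) \<and>
    (\<forall>g\<in>carrier (l2_space R). \<forall>h\<in>carrier (l2_space R). \<phi> (\<lambda>r. g r + h r) = \<phi> g + \<phi> h) \<and>
    (\<forall>a. \<forall>g\<in>carrier (l2_space R). \<phi> (\<lambda>r. a * g r) = a * \<phi> g)" (is "?L \<longleftrightarrow> ?R")
proof
  show "?L \<Longrightarrow> ?R"
    by (simp add: dual_space_def bounded_ops_def PiE_def)
next
  assume lin: ?R
  have "cmod (\<phi> f) \<le> (\<Sum>r\<in>R. cmod (\<phi> (indicator {r}))) * vnorm (l2_space R) f"
    if f: "f \<in> carrier (l2_space R)" for f
  proof -
    have "\<phi> f = (\<Sum>r\<in>R. f r * \<phi> (indicator {r}))"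
      using lin by (intro l2_expansion[OF R _ _ f]) blast+
    then have "cmod (\<phi> f) \<le> (\<Sum>r\<in>R. cmod (f r * \<phi> (indicator {r})))"
      by (simp add: norm_sum)
    also have "\<dots> \<le> (\<Sum>r\<in>R. cmod (\<phi> (indicator {r})) * vnorm (l2_space R) f)"
      using member_le_L2_set[OF R, of _ "\<lambda>r. cmod (f r)"]
      by (intro sum_mono) (simp add: norm_mult mult.commute[of "cmod (f _)"] mult_left_mono)
    finally show ?thesis by (simp only: sum_distrib_right)
  qed
  then have "\<exists>K. \<forall>f\<in>carrier (l2_space R). cmod (\<phi> f) \<le> K * vnorm (l2_space R) f" by blast
  then show ?L
    using lin by (simp add: dual_space_def bounded_ops_def PiE_def)
qed

text \<open>
  The unit vectors of the standard basis take part in the supremum that defines the operator norm.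
\<close>

lemma functional_le_op_norm:
  assumes R: "finite R" and \<phi>: "\<phi> \<in> carrier (dual_space (l2_space R))" and r: "r \<in> R"
  shows "cmod (\<phi> (indicator {r})) \<le> vnorm (dual_space (l2_space R)) \<phi>"
proof -
  let ?B = "{f \<in> carrier (l2_space R). vnorm (l2_space R) f \<le> 1}"
  have "\<exists>K. \<forall>f\<in>carrier (l2_space R). cmod (\<phi> f) \<le> K * vnorm (l2_space R) f"
    using \<phi> by (simp add: dual_space_def bounded_ops_def)
  then obtain K where K: "\<And>f. f \<in> carrier (l2_space R) \<Longrightarrow> cmod (\<phi> f) \<le> K * vnorm (l2_space R) f"
    by blast
  have "cmod (\<phi> f) \<le> \<bar>K\<bar>" if "f \<in> ?B" for f
  proof -
    have "cmod (\<phi> f) \<le> K * vnorm (l2_space R) f" using K that by blast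
    also have "\<dots> \<le> \<bar>K\<bar> * 1" using that by (intro mult_mono) (auto simp: L2_set_nonneg)
    finally show ?thesis by simp
  qed
  then have "bdd_above ((\<lambda>f. cmod (\<phi> f)) ` ?B)" by (intro bdd_aboveI2)
  moreover have "indicator {r} \<in> ?B"
  proof -
    have "(\<Sum>s\<in>R. (cmod (indicator {r} s))\<^sup>2) = (\<Sum>s\<in>R. if s = r then 1 else 0)"
      by (intro sum.cong) auto
    then have "vnorm (l2_space R) (indicator {r}) \<le> 1"
      using R r by (simp add: L2_set_def)
    moreover have "indicator {r} \<in> carrier (l2_space R)"
      using r by (auto simp: indicator_def)
    ultimately show ?thesis by blast
  qed
  ultimately show ?thesis
    unfolding dual_space_def op_space_simps op_norm_def complex_space_simps by (rule cSUP_upper[rotated])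
qed

definition coordinate_functional :: "'i set \<Rightarrow> 'i \<Rightarrow> ('i \<Rightarrow> complex) \<Rightarrow> complex" where
  "coordinate_functional R r = (\<lambda>f\<in>carrier (l2_space R). f r)"

lemma coordinate_functional_in_dual:
  "finite R \<Longrightarrow> coordinate_functional R r \<in> carrier (dual_space (l2_space R))"
  by (simp add: dual_l2_space_iff coordinate_functional_def)

text \<open>
  Every functional is the combination \<open>\<Sum>r. \<phi>(e\<^sub>r) \<delta>\<^sub>r\<close> of the coordinate functionals \<open>\<delta>\<^sub>r\<close>. So an
  element \<open>\<Psi>\<close> of the bidual is evaluation at the vector with coordinates \<open>\<Psi>(\<delta>\<^sub>r)\<close>.
\<close>

lemma reflexive_l2_space:
  assumes R: "finite R"
  shows "reflexive_space (l2_space R)"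
proof -
  let ?E = "l2_space R" let ?D = "dual_space (l2_space R)"
  have D_add: "\<phi> \<oplus>\<^bsub>?D\<^esub> \<psi> = (\<lambda>f\<in>carrier ?E. \<phi> f + \<psi> f)"
    and D_smult: "a \<odot>\<^bsub>?D\<^esub> \<phi> = (\<lambda>f\<in>carrier ?E. a * \<phi> f)" for \<phi> \<psi> a
    by (simp_all add: dual_space_def)
  have closed: "\<phi> \<oplus>\<^bsub>?D\<^esub> \<psi> \<in> carrier ?D" "a \<odot>\<^bsub>?D\<^esub> \<phi> \<in> carrier ?D"
    if "\<phi> \<in> carrier ?D" "\<psi> \<in> carrier ?D" for \<phi> \<psi> a
    using that unfolding D_add D_smult dual_l2_space_iff[OF R] by (simp_all add: algebra_simps)
  have expand: "\<phi> f = (\<Sum>r\<in>R. f r * \<phi> (indicator {r}))"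
    if \<phi>: "\<phi> \<in> carrier ?D" and f: "f \<in> carrier ?E" for \<phi> f
    using \<phi> unfolding dual_l2_space_iff[OF R] by (intro l2_expansion[OF R _ _ f]) blast+
  show ?thesis
    unfolding reflexive_space_def
  proof (intro equalityI subsetI)
    fix \<Psi> assume "\<Psi> \<in> (\<lambda>f. \<lambda>\<phi>\<in>carrier ?D. \<phi> f) ` carrier ?E"
    then obtain f where f: "f \<in> carrier ?E" and \<Psi>: "\<Psi> = (\<lambda>\<phi>\<in>carrier ?D. \<phi> f)" by blast
    have bound: "cmod (\<phi> f) \<le> (\<Sum>r\<in>R. cmod (f r)) * vnorm ?D \<phi>" if \<phi>: "\<phi> \<in> carrier ?D" for \<phi>
    proof -
      have "cmod (\<phi> f) \<le> (\<Sum>r\<in>R. cmod (f r * \<phi> (indicator {r})))"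
        unfolding expand[OF \<phi> f] by (rule norm_sum)
      also have "\<dots> \<le> (\<Sum>r\<in>R. cmod (f r) * vnorm ?D \<phi>)"
        using functional_le_op_norm[OF R \<phi>]
        by (intro sum_mono) (simp add: norm_mult mult_left_mono)
      finally show ?thesis by (simp only: sum_distrib_right)
    qed
    show "\<Psi> \<in> carrier (dual_space ?D)"
      unfolding dual_space_def[of ?D] op_space_simps bounded_ops_def
    proof (intro CollectI conjI ballI allI)
      show "\<Psi> \<in> carrier ?D \<rightarrow>\<^sub>E carrier complex_space" by (simp add: \<Psi>)
      show "\<Psi> (\<phi> \<oplus>\<^bsub>?D\<^esub> \<psi>) = \<Psi> \<phi> \<oplus>\<^bsub>complex_space\<^esub> \<Psi> \<psi>"
        if "\<phi> \<in> carrier ?D" "\<psi> \<in> carrier ?D" for \<phi> \<psi>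
      proof -
        have "(\<phi> \<oplus>\<^bsub>?D\<^esub> \<psi>) f = \<phi> f + \<psi> f" using f by (simp add: D_add)
        then show ?thesis using closed(1)[OF that] that by (simp add: \<Psi>)
      qed
      show "\<Psi> (a \<odot>\<^bsub>?D\<^esub> \<phi>) = a \<odot>\<^bsub>complex_space\<^esub> \<Psi> \<phi>" if "\<phi> \<in> carrier ?D" for a \<phi>
      proof -
        have "(a \<odot>\<^bsub>?D\<^esub> \<phi>) f = a * \<phi> f" using f by (simp add: D_smult)
        then show ?thesis using closed(2)[OF that that] that by (simp add: \<Psi>)
      qed
      show "\<exists>K. \<forall>\<phi>\<in>carrier ?D. vnorm complex_space (\<Psi> \<phi>) \<le> K * vnorm ?D \<phi>"
        by (rule exI[of _ "\<Sum>r\<in>R. cmod (f r)"]) (simp add: \<Psi> bound)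
    qed
  next
    fix \<Psi> assume "\<Psi> \<in> carrier (dual_space ?D)"
    then have ext: "\<Psi> \<in> extensional (carrier ?D)"
      and add: "\<And>\<phi> \<psi>. \<lbrakk>\<phi> \<in> carrier ?D; \<psi> \<in> carrier ?D\<rbrakk> \<Longrightarrow> \<Psi> (\<phi> \<oplus>\<^bsub>?D\<^esub> \<psi>) = \<Psi> \<phi> + \<Psi> \<psi>"
      and smult: "\<And>a \<phi>. \<phi> \<in> carrier ?D \<Longrightarrow> \<Psi> (a \<odot>\<^bsub>?D\<^esub> \<phi>) = a * \<Psi> \<phi>"
      by (simp_all add: dual_space_def[of ?D] bounded_ops_def PiE_def)
    define f where "f r = (if r \<in> R then \<Psi> (coordinate_functional R r) else 0)" for r
    have f: "f \<in> carrier ?E" by (simp add: f_def)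
    have comb: "\<Psi> (\<lambda>g\<in>carrier ?E. \<Sum>r\<in>A. g r * c r) = (\<Sum>r\<in>A. f r * c r)" if "A \<subseteq> R" for A c
      using finite_subset[OF that R] that
    proof (induction A rule: finite_induct)
      case empty
      have "(\<lambda>g\<in>carrier ?E. \<Sum>r\<in>{}. g r * c r) = 0 \<odot>\<^bsub>?D\<^esub> coordinate_functional R undefined"
        unfolding D_smult by (rule restrict_ext) simp
      then show ?case
        by (simp only: smult[OF coordinate_functional_in_dual[OF R]]) simp
    next
      case (insert a A)
      let ?\<phi> = "\<lambda>g\<in>carrier ?E. \<Sum>r\<in>A. g r * c r"
      have \<phi>: "?\<phi> \<in> carrier ?D"
        unfolding dual_l2_space_iff[OF R]
        by (simp add: algebra_simps sum.distrib sum_distrib_left)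
      have "(\<lambda>g\<in>carrier ?E. \<Sum>r\<in>insert a A. g r * c r)
          = (c a \<odot>\<^bsub>?D\<^esub> coordinate_functional R a) \<oplus>\<^bsub>?D\<^esub> ?\<phi>"
        unfolding D_add D_smult using insert.hyps
        by (intro restrict_ext) (simp add: coordinate_functional_def mult.commute)
      then have "\<Psi> (\<lambda>g\<in>carrier ?E. \<Sum>r\<in>insert a A. g r * c r)
          = c a * \<Psi> (coordinate_functional R a) + \<Psi> ?\<phi>"
        using \<phi> coordinate_functional_in_dual[OF R, of a] by (simp only: add smult closed(2))
      also have "\<Psi> ?\<phi> = (\<Sum>r\<in>A. f r * c r)"
        using insert.IH insert.prems by blast
      also have "c a * \<Psi> (coordinate_functional R a) = f a * c a"
        using insert.prems by (simp add: f_def)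
      finally show ?case using insert.hyps by simp
    qed
    have "\<Psi> \<phi> = \<phi> f" if \<phi>: "\<phi> \<in> carrier ?D" for \<phi>
    proof -
      have "\<phi> = (\<lambda>g\<in>carrier ?E. \<Sum>r\<in>R. g r * \<phi> (indicator {r}))"
      proof (rule extensionalityI)
        show "\<phi> \<in> extensional (carrier ?E)" using \<phi> dual_l2_space_iff[OF R] by blast
      qed (use expand[OF \<phi>] in simp_all)
      then have "\<Psi> \<phi> = (\<Sum>r\<in>R. f r * \<phi> (indicator {r}))"
        using comb[of R "\<lambda>r. \<phi> (indicator {r})"] by (metis order_refl)
      then show ?thesis using expand[OF \<phi> f] by simp
    qed
    then have "\<Psi> = (\<lambda>\<phi>\<in>carrier ?D. \<phi> f)"
      using ext by (intro extensionalityI[of _ "carrier ?D"]) simp_all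
    then show "\<Psi> \<in> (\<lambda>f. \<lambda>\<phi>\<in>carrier ?D. \<phi> f) ` carrier ?E"
      using f by blast
  qed
qed

section \<open>Permutation representations\<close>

definition permutation_operator :: "'i set \<Rightarrow> ('i \<Rightarrow> 'i) \<Rightarrow> ('i \<Rightarrow> complex) \<Rightarrow> 'i \<Rightarrow> complex" where
  "permutation_operator R \<sigma> = (\<lambda>f\<in>carrier (l2_space R). \<lambda>r. if r \<in> R then f (\<sigma> r) else 0)"

lemma permutation_operator_isometry:
  assumes "bij_betw \<sigma> R R" "f \<in> carrier (l2_space R)" "g \<in> carrier (l2_space R)"
  shows "l2_inner R (permutation_operator R \<sigma> f) (permutation_operator R \<sigma> g) = l2_inner R f g"
    and "vnorm (l2_space R) (permutation_operator R \<sigma> f) = vnorm (l2_space R) f"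
  using assms(2,3) sum.reindex_bij_betw[OF assms(1), of "\<lambda>r. f r * cnj (g r)"]
    sum.reindex_bij_betw[OF assms(1), of "\<lambda>r. (cmod (f r))\<^sup>2"]
  by (simp_all add: permutation_operator_def l2_inner_def L2_set_def)

lemma permutation_operator_bounded:
  assumes "bij_betw \<sigma> R R"
  shows "permutation_operator R \<sigma> \<in> bounded_ops (l2_space R) (l2_space R)"
  unfolding bounded_ops_def
proof (intro CollectI conjI)
  show "permutation_operator R \<sigma> \<in> carrier (l2_space R) \<rightarrow>\<^sub>E carrier (l2_space R)"
    by (auto simp: permutation_operator_def)
  show "\<exists>K. \<forall>f\<in>carrier (l2_space R). vnorm (l2_space R) (permutation_operator R \<sigma> f) \<le> K * vnorm (l2_space R) f"
    by (intro exI[of _ 1] ballI) (simp only: permutation_operator_isometry(2)[OF assms] mult_1 order_refl)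
qed (auto simp: permutation_operator_def fun_eq_iff)

text \<open>
  Composition of operators reverses the order of the permutations. An action from the right therefore
  gives a homomorphism.
\<close>

lemma permutation_operator_compose:
  assumes "\<tau> \<in> R \<rightarrow> R"
  shows "compose (carrier (l2_space R)) (permutation_operator R \<tau>) (permutation_operator R \<sigma>)
    = permutation_operator R (\<sigma> \<circ> \<tau>)"
  unfolding permutation_operator_def compose_def
  by (rule restrict_ext) (use assms in \<open>auto simp: fun_eq_iff\<close>)

lemma permutation_operator_id:
  "permutation_operator R id = (\<lambda>f\<in>carrier (l2_space R). f)"
  unfolding permutation_operator_def by (rule restrict_ext) (auto simp: fun_eq_iff)

lemma permutation_operator_cong:
  "(\<And>r. r \<in> R \<Longrightarrow> \<sigma> r = \<tau> r) \<Longrightarrow> permutation_operator R \<sigma> = permutation_operator R \<tau>"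
  by (auto simp: permutation_operator_def fun_eq_iff)

text \<open>
  A finite set with a right action whose point transporters are open, which is continuity of the action
  for the discrete topology on the set.
\<close>

locale continuous_permutation_action = topological_group +
  fixes R :: "'i set" and act :: "'i \<Rightarrow> 'a \<Rightarrow> 'i"
  assumes finite_R: "finite R"
    and act_closed: "\<lbrakk>r \<in> R; g \<in> carrier G\<rbrakk> \<Longrightarrow> act r g \<in> R"
    and act_one: "r \<in> R \<Longrightarrow> act r \<one> = r"
    and act_mult: "\<lbrakk>r \<in> R; g \<in> carrier G; h \<in> carrier G\<rbrakk> \<Longrightarrow> act r (g \<otimes> h) = act (act r g) h"
    and act_continuous: "\<lbrakk>r \<in> R; s \<in> R\<rbrakk> \<Longrightarrow> openin T {g \<in> carrier G. act r g = s}"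
begin

definition perm_rep :: "'a \<Rightarrow> ('i \<Rightarrow> complex) \<Rightarrow> 'i \<Rightarrow> complex" where
  "perm_rep g = permutation_operator R (\<lambda>r. act r g)"

lemma act_bij: "g \<in> carrier G \<Longrightarrow> bij_betw (\<lambda>r. act r g) R R"
  by (rule bij_betwI[where g = "\<lambda>r. act r (inv g)"])
    (auto simp: act_closed act_mult[symmetric] act_one)

lemma perm_rep_mult:
  assumes "g \<in> carrier G" "h \<in> carrier G"
  shows "perm_rep (g \<otimes> h) = compose (carrier (l2_space R)) (perm_rep g) (perm_rep h)"
proof -
  have "(\<lambda>r. act r g) \<in> R \<rightarrow> R" using assms by (auto simp: act_closed)
  from permutation_operator_compose[OF this] show ?thesis
    unfolding perm_rep_def by (simp, intro permutation_operator_cong) (simp add: act_mult assms)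
qed

lemma perm_rep_one: "perm_rep \<one> = (\<lambda>f\<in>carrier (l2_space R). f)"
  unfolding perm_rep_def permutation_operator_id[symmetric]
  by (intro permutation_operator_cong) (simp add: act_one)

lemma perm_rep_hom: "perm_rep \<in> hom G (units_of (op_monoid (l2_space R)))"
proof (rule homI)
  have bdd: "perm_rep g \<in> bounded_ops (l2_space R) (l2_space R)" if "g \<in> carrier G" for g
    unfolding perm_rep_def by (rule permutation_operator_bounded[OF act_bij[OF that]])
  show "perm_rep g \<in> carrier (units_of (op_monoid (l2_space R)))" if g: "g \<in> carrier G" for g
  proof -
    have "compose (carrier (l2_space R)) (perm_rep (inv g)) (perm_rep g) = (\<lambda>f\<in>carrier (l2_space R). f)"
      "compose (carrier (l2_space R)) (perm_rep g) (perm_rep (inv g)) = (\<lambda>f\<in>carrier (l2_space R). f)"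
      using g perm_rep_mult[of "inv g" g] perm_rep_mult[of g "inv g"] by (simp_all only: inv_closed l_inv r_inv perm_rep_one)
    then show ?thesis
      using bdd[OF g] bdd[of "inv g"] g unfolding units_of_def Units_def op_monoid_def by auto
  qed
  show "perm_rep (g \<otimes> h) = perm_rep g \<otimes>\<^bsub>units_of (op_monoid (l2_space R))\<^esub> perm_rep h"
    if "g \<in> carrier G" "h \<in> carrier G" for g h
    using perm_rep_mult[OF that] by (simp add: units_of_def op_monoid_def)
qed

lemma openin_act_fibre:
  assumes "g \<in> carrier G"
  shows "openin T {h \<in> carrier G. \<forall>r\<in>R. act r h = act r g}"
proof -
  have "{h \<in> carrier G. \<forall>r\<in>R. act r h = act r g} = topspace T \<inter> (\<Inter>r\<in>R. {h \<in> carrier G. act r h = act r g})"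
    by (auto simp: topspace_eq)
  also have "openin T \<dots>"
    using finite_R act_continuous assms act_closed
    by (cases "R = {}") (auto intro!: openin_Int openin_Inter)
  finally show ?thesis .
qed

text \<open>
  The operator of \<open>g\<close> depends only on the permutation that \<open>g\<close> induces, and the elements that induce a
  given permutation form an open set. So the representation is locally constant, and continuous for
  every topology on the operators.
\<close>

lemma perm_rep_continuous: "continuous_map T (strong_op_topology (l2_space R)) perm_rep"
  unfolding continuous_map
proof (intro conjI allI impI)
  interpret complex_banach_space "l2_space R"
    using finite_R by (rule complex_banach_space_l2_space)
  have "bounded_ops (l2_space R) (l2_space R) \<subseteq> topspace (strong_op_topology (l2_space R))"
    by (auto simp: strong_op_topology_def topspace_norm_topology bounded_ops_def)
  then show "perm_rep ` topspace T \<subseteq> topspace (strong_op_topology (l2_space R))"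
    using permutation_operator_bounded[OF act_bij] by (auto simp: perm_rep_def topspace_eq)
  fix U assume "openin (strong_op_topology (l2_space R)) U"
  have "{g \<in> carrier G. perm_rep g \<in> U} =
      (\<Union>g\<in>{g \<in> carrier G. perm_rep g \<in> U}. {h \<in> carrier G. \<forall>r\<in>R. act r h = act r g})" (is "?A = ?B")
  proof
    show "?A \<subseteq> ?B" by blast
    show "?B \<subseteq> ?A"
    proof
      fix h assume "h \<in> ?B"
      then obtain g where "perm_rep g \<in> U" "h \<in> carrier G" "\<forall>r\<in>R. act r h = act r g" by blast
      then show "h \<in> ?A"
        using permutation_operator_cong[of R "\<lambda>r. act r h" "\<lambda>r. act r g"] by (simp add: perm_rep_def)
    qed
  qed
  moreover have "openin T ?B"
    using openin_act_fibre by (intro openin_Union) blast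
  ultimately show "openin T {g \<in> topspace T. perm_rep g \<in> U}"
    by (simp only: topspace_eq)
qed

lemma perm_rep_unitary: "unitary_representation G T (l2_space R) (l2_inner R) perm_rep"
  unfolding unitary_representation_def banach_representation_def
  using complex_hilbert_space_l2_space[OF finite_R] complex_banach_space_l2_space[OF finite_R]
    perm_rep_hom perm_rep_continuous permutation_operator_isometry(1)[OF act_bij]
  by (simp add: perm_rep_def)

lemma perm_rep_uniformly_bounded: "uniformly_bounded G (l2_space R) perm_rep"
  unfolding uniformly_bounded_def
proof (rule bdd_aboveI2)
  fix g assume g: "g \<in> carrier G"
  show "op_norm (l2_space R) (l2_space R) (perm_rep g) \<le> 1"
    unfolding op_norm_def
  proof (rule cSUP_least)
    show "{f \<in> carrier (l2_space R). vnorm (l2_space R) f \<le> 1} \<noteq> {}"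
      by (auto simp: L2_set_def intro!: exI[of _ "\<lambda>_. 0"])
    show "vnorm (l2_space R) (perm_rep g f) \<le> 1"
      if "f \<in> {f \<in> carrier (l2_space R). vnorm (l2_space R) f \<le> 1}" for f
      using that permutation_operator_isometry(2)[OF act_bij[OF g], of f f]
      unfolding perm_rep_def by simp
  qed
qed

text \<open>
  The vector is the indicator function of the part of the finite set that lies in \<open>C\<close>, and the functional
  evaluates at the base point \<open>s\<close>.
\<close>

lemma orbit_indicator_coefficient:
  assumes "s \<in> R" "\<And>g. g \<in> carrier G \<Longrightarrow> act s g \<in> C \<longleftrightarrow> g \<in> D"
  shows "coefficient_function G (l2_space R) perm_rep (indicator D)"
  unfolding coefficient_function_def
proof (intro bexI ballI)
  show "indicator (C \<inter> R) \<in> carrier (l2_space R)" by simp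
  then show "indicator D g = coordinate_functional R s (perm_rep g (indicator (C \<inter> R)))" if "g \<in> carrier G" for g
    using assms act_closed[OF assms(1) that] that
    by (simp add: coordinate_functional_def perm_rep_def permutation_operator_def indicator_def)
qed (rule coordinate_functional_in_dual[OF finite_R])

end

section \<open>Indicator functions of clopen sets\<close>

text \<open>
  The right cosets of \<open>H\<close> are represented by chosen elements of the group, so that functions on the finite
  set of cosets become functions on the group type, as the universe of the Fourier--Stieltjes algebra
  requires.
\<close>

definition coset_rep :: "('g, 'm) monoid_scheme \<Rightarrow> 'g set \<Rightarrow> 'g \<Rightarrow> 'g" where
  "coset_rep G H x = (SOME a. a \<in> H #>\<^bsub>G\<^esub> x)"

context topological_group
begin

lemma coset_rep_in_coset:
  assumes "subgroup H G" "x \<in> carrier G"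
  shows "coset_rep G H x \<in> H #> x"
  unfolding coset_rep_def by (rule someI[of "\<lambda>a. a \<in> H #> x", OF rcos_self[OF assms(2,1)]])

lemma coset_rep_closed:
  assumes "subgroup H G" "x \<in> carrier G"
  shows "coset_rep G H x \<in> carrier G"
  using coset_rep_in_coset[OF assms] r_coset_subset_G[OF subgroup.subset[OF assms(1)] assms(2)] by blast

lemma r_coset_coset_rep:
  assumes "subgroup H G" "x \<in> carrier G"
  shows "H #> coset_rep G H x = H #> x"
  using repr_independence[OF coset_rep_in_coset[OF assms] assms(2,1)] by simp

lemma coset_rep_mult:
  assumes "subgroup H G" "x \<in> carrier G" "g \<in> carrier G"
  shows "coset_rep G H (coset_rep G H x \<otimes> g) = coset_rep G H (x \<otimes> g)"
proof -
  have "H #> (coset_rep G H x \<otimes> g) = H #> (x \<otimes> g)"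
    using assms coset_mult_assoc[OF subgroup.subset[OF assms(1)]] coset_rep_closed r_coset_coset_rep
    by metis
  then show ?thesis by (simp add: coset_rep_def)
qed

lemma coset_rep_idem:
  assumes "subgroup H G" "x \<in> carrier G"
  shows "coset_rep G H (coset_rep G H x) = coset_rep G H x"
  using r_coset_coset_rep[OF assms] by (simp add: coset_rep_def)

text \<open>
  This is the right translation action on the right cosets of \<open>H\<close>, carried over to their chosen
  representatives. The elements that take one coset to another form a translate of a coset, which is
  open.
\<close>

lemma coset_action:
  assumes H: "subgroup H G" "openin T H" and fin: "finite (rcosets H)"
  shows "continuous_permutation_action G T (coset_rep G H ` carrier G) (\<lambda>r g. coset_rep G H (r \<otimes> g))"
proof unfold_locales
  let ?\<rho> = "coset_rep G H"
  have "?\<rho> ` carrier G \<subseteq> (\<lambda>A. SOME a. a \<in> A) ` (rcosets H)"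
    using rcosetsI[OF subgroup.subset[OF H(1)]] by (auto simp: coset_rep_def)
  then show "finite (?\<rho> ` carrier G)"
    using fin finite_surj by blast
  show "?\<rho> (r \<otimes> g) \<in> ?\<rho> ` carrier G" if "r \<in> ?\<rho> ` carrier G" "g \<in> carrier G" for r g
    using that coset_rep_closed[OF H(1)] by auto
  show "?\<rho> (r \<otimes> \<one>) = r" if "r \<in> ?\<rho> ` carrier G" for r
    using that coset_rep_closed[OF H(1)] coset_rep_idem[OF H(1)] by auto
  show "?\<rho> (r \<otimes> (g \<otimes> h)) = ?\<rho> (?\<rho> (r \<otimes> g) \<otimes> h)"
    if "r \<in> ?\<rho> ` carrier G" "g \<in> carrier G" "h \<in> carrier G" for r g h
  proof -
    have "r \<in> carrier G" using that(1) coset_rep_closed[OF H(1)] by blast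
    then show ?thesis using that(2,3) by (simp add: coset_rep_mult[OF H(1)] m_assoc)
  qed
  show "openin T {g \<in> carrier G. ?\<rho> (r \<otimes> g) = s}"
    if "r \<in> ?\<rho> ` carrier G" "s \<in> ?\<rho> ` carrier G" for r s
  proof -
    have r: "r \<in> carrier G" and s: "s \<in> carrier G" using that coset_rep_closed[OF H(1)] by blast+
    have \<rho>s: "?\<rho> s = s" using that(2) coset_rep_idem[OF H(1)] by auto
    have "?\<rho> (r \<otimes> g) = s \<longleftrightarrow> r \<otimes> g \<in> H #> s" if g: "g \<in> carrier G" for g
    proof
      show "?\<rho> (r \<otimes> g) = s \<Longrightarrow> r \<otimes> g \<in> H #> s"
        using r_coset_coset_rep[OF H(1), of "r \<otimes> g"] rcos_self[OF _ H(1), of "r \<otimes> g"] r g by simp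
      assume "r \<otimes> g \<in> H #> s"
      then have "H #> s = H #> (r \<otimes> g)" using repr_independence[OF _ s H(1)] by simp
      then show "?\<rho> (r \<otimes> g) = s" using \<rho>s by (simp add: coset_rep_def)
    qed
    then have "{g \<in> carrier G. ?\<rho> (r \<otimes> g) = s} = {g \<in> carrier G. r \<otimes> g \<in> H #> s}" by blast
    then show ?thesis
      using openin_left_preimage[OF openin_r_coset[OF H(2) s] r] by simp
  qed
qed

text \<open>
  The right cosets of the left stabilizer \<open>H\<close> of \<open>C\<close> lie in \<open>C\<close> or in its complement, and the
  element \<open>g\<close> takes the coset \<open>H\<close> to \<open>H g\<close>. So \<open>C\<close> is the set of elements that take the base
  point into \<open>C\<close>, in the situation of \<open>orbit_indicator_coefficient\<close>.
\<close>

lemma clopen_indicator_coefficient: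
  assumes ac: "almost_connected G T" and C: "openin T C" "closedin T C"
  shows "\<exists>(E :: ('a \<Rightarrow> complex) normed_space) ip \<pi>. unitary_representation G T E ip \<pi> \<and>
    uniformly_bounded G E \<pi> \<and> reflexive_space E \<and> coefficient_function G E \<pi> (indicator C)"
proof -
  let ?H = "left_stabilizer C" let ?\<rho> = "coset_rep G ?H"
  have H: "subgroup ?H G" "openin T ?H"
    using subgroup_left_stabilizer openin_left_stabilizer[OF ac C] by auto
  interpret A: continuous_permutation_action G T "?\<rho> ` carrier G" "\<lambda>r g. ?\<rho> (r \<otimes> g)"
    by (rule coset_action[OF H open_subgroup_finite_index[OF ac H]])
  have "?\<rho> (?\<rho> \<one> \<otimes> g) \<in> C \<longleftrightarrow> g \<in> C" if g: "g \<in> carrier G" for g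
  proof -
    have "?\<rho> g \<in> ?H #> g" using coset_rep_in_coset[OF H(1) g] .
    then obtain h where "h \<in> ?H" "?\<rho> g = h \<otimes> g" by (auto simp: r_coset_def)
    then have "?\<rho> g \<in> C \<longleftrightarrow> g \<in> C" using g by (simp add: left_stabilizer_def)
    then show ?thesis using coset_rep_mult[OF H(1) one_closed g] g by simp
  qed
  then have "coefficient_function G (l2_space (?\<rho> ` carrier G)) A.perm_rep (indicator C)"
    by (intro A.orbit_indicator_coefficient[of "?\<rho> \<one>" C]) auto
  then show ?thesis
    using A.perm_rep_unitary A.perm_rep_uniformly_bounded reflexive_l2_space[OF A.finite_R] by blast
qed

lemma coefficient_indicator_in_coset_ring:
  assumes "almost_connected G T" "C \<subseteq> carrier G"
    and "banach_representation G T E \<pi>" "coefficient_function G E \<pi> (indicator C)"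
  shows "C \<in> coset_ring G T"
  using clopen_in_coset_ring[OF assms(1)]
    clopen_if_continuous_indicator[OF continuous_coefficient_function[OF assms(3,4) topspace_eq]]
    assms(2) by (simp add: topspace_eq)

end

theorem theorem1p3:
  fixes G :: "('g, 'm) monoid_scheme" and T :: "'g topology" and C :: "'g set"
  assumes "locally_compact_group G T"
    and "almost_connected G T"
    and "C \<subseteq> carrier G"
  shows
    "(C \<in> coset_ring G T \<longleftrightarrow> indicator C \<in> fourier_stieltjes G T TYPE('g \<Rightarrow> complex)) \<and>
     (C \<in> coset_ring G T \<longleftrightarrow>
        (\<exists>(E :: ('g \<Rightarrow> complex) normed_space) \<pi>. banach_representation G T E \<pi> \<and>
           uniformly_bounded G E \<pi> \<and> reflexive_space E \<and>
           coefficient_function G E \<pi> (indicator C))) \<and>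
     (indicator C \<in> fourier_stieltjes G T TYPE('v) \<longrightarrow> C \<in> coset_ring G T) \<and>
     ((\<exists>(E :: 'w normed_space) \<pi>. banach_representation G T E \<pi> \<and>
           uniformly_bounded G E \<pi> \<and> reflexive_space E \<and>
           coefficient_function G E \<pi> (indicator C)) \<longrightarrow> C \<in> coset_ring G T)"
proof -
  interpret locally_compact_group G T by fact
  have "\<exists>(E :: ('g \<Rightarrow> complex) normed_space) ip \<pi>. unitary_representation G T E ip \<pi> \<and>
      uniformly_bounded G E \<pi> \<and> reflexive_space E \<and> coefficient_function G E \<pi> (indicator C)"
    if "C \<in> coset_ring G T"
    using clopen_indicator_coefficient[OF assms(2)] coset_ring_clopen[OF that] by blast
  then have forward: "C \<in> coset_ring G T \<Longrightarrow> indicator C \<in> fourier_stieltjes G T TYPE('g \<Rightarrow> complex)"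
      "C \<in> coset_ring G T \<Longrightarrow> \<exists>(E :: ('g \<Rightarrow> complex) normed_space) \<pi>. banach_representation G T E \<pi> \<and>
         uniformly_bounded G E \<pi> \<and> reflexive_space E \<and> coefficient_function G E \<pi> (indicator C)"
    unfolding fourier_stieltjes_def unitary_representation_def by blast+
  note backward = coefficient_indicator_in_coset_ring[OF assms(2,3)]
  have fs: "C \<in> coset_ring G T" if "indicator C \<in> fourier_stieltjes G T TYPE('g \<Rightarrow> complex)"
    using that backward unfolding fourier_stieltjes_def unitary_representation_def by blast
  have fs': "C \<in> coset_ring G T" if "indicator C \<in> fourier_stieltjes G T TYPE('v)"
    using that backward unfolding fourier_stieltjes_def unitary_representation_def by blast
  show ?thesis
  proof (intro conjI iffI impI)
    show "C \<in> coset_ring G T" if "\<exists>(E :: ('g \<Rightarrow> complex) normed_space) \<pi>. banach_representation G T E \<pi> \<and>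
      uniformly_bounded G E \<pi> \<and> reflexive_space E \<and> coefficient_function G E \<pi> (indicator C)"
      using that backward by blast
    show "C \<in> coset_ring G T" if "\<exists>(E :: 'w normed_space) \<pi>. banach_representation G T E \<pi> \<and>
      uniformly_bounded G E \<pi> \<and> reflexive_space E \<and> coefficient_function G E \<pi> (indicator C)"
      using that backward by blast
  qed (fact forward fs fs')+
qed

end
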